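(* $\mathrm{Homeo}_+(\mathbb R)$ is the only proper subgroup of $\mathrm{Homeo}(\mathbb R)$ of index $<2^{\aleph_0}$. Similarly, $\mathrm{Homeo}_+(S^1)$ is the only proper subgroup of $\mathrm{Homeo}(S^1)$ of index $<2^{\aleph_0}$.
   Context: $\mathrm{Homeo}(\mathbb R)$ is the group of all homeomorphisms of $\mathbb R$ and $\mathrm{Homeo}_+(\mathbb R)$ its subgroup of increasing homeomorphisms; $\mathrm{Homeo}(S^1)$ is the group of all homeomorphisms of the unit circle and $\mathrm{Homeo}_+(S^1)$ its subgroup of orientation-preserving homeomorphisms. Index refers to the index of a subgroup in the abstract group. *)

theory Defs
  imports "HOL-Analysis.Analysis" "HOL-Algebra.Bij" "HOL-Algebra.Coset"
begin

(* A homeomorphism of X is represented by its extensional function (as in Bij), so that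
   elements of the group are determined by their values on the points of X. *)
definition Homeo :: "'a topology \<Rightarrow> ('a \<Rightarrow> 'a) set" where
  "Homeo X = {f \<in> extensional (topspace X). homeomorphic_map X X f}"

definition Homeo_group :: "'a topology \<Rightarrow> ('a \<Rightarrow> 'a) monoid" where
  "Homeo_group X = (BijGroup (topspace X))\<lparr>carrier := Homeo X\<rparr>"

abbreviation circle :: "complex topology" where
  "circle \<equiv> top_of_set (sphere 0 1)"

definition Homeo_plus_real :: "(real \<Rightarrow> real) set" where
  "Homeo_plus_real = {f \<in> Homeo euclideanreal. strict_mono f}"

(* A homeomorphism of the circle preserves orientation if it has an increasing continuous
   lift along the universal covering t \<mapsto> cis t = exp (i t). *)
definition Homeo_plus_circle :: "(complex \<Rightarrow> complex) set" where
  "Homeo_plus_circle = {f \<in> Homeo circle.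
     \<exists>F :: real \<Rightarrow> real. continuous_on UNIV F \<and> strict_mono F \<and> (\<forall>t. f (cis t) = cis (F t))}"

lemma Homeo_subset_Bij: "Homeo X \<subseteq> Bij (topspace X)"
  by (auto simp: Homeo_def Bij_def bij_betw_def dest: homeomorphic_imp_injective_map
      homeomorphic_imp_surjective_map)

lemma subgroup_Homeo: "subgroup (Homeo X) (BijGroup (topspace X))"
proof (rule group.subgroupI [OF group_BijGroup])
  show "Homeo X \<subseteq> carrier (BijGroup (topspace X))"
    using Homeo_subset_Bij by (simp add: BijGroup_def)
  have "homeomorphic_map X X (restrict id (topspace X))"
    by (rule homeomorphic_map_eq [of X X id]) auto
  then have "restrict id (topspace X) \<in> Homeo X"
    by (simp add: Homeo_def)
  then show "Homeo X \<noteq> {}" by blast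
next
  fix f assume f: "f \<in> Homeo X"
  then have fB: "f \<in> Bij (topspace X)"
    using Homeo_subset_Bij by blast
  obtain g where g: "homeomorphic_maps X X f g"
    using f by (auto simp: Homeo_def homeomorphic_map_maps)
  then have gm: "homeomorphic_map X X g" and fg: "\<And>y. y \<in> topspace X \<Longrightarrow> f (g y) = y"
    by (auto simp: homeomorphic_maps_map)
  have "g y = restrict (inv_into (topspace X) f) (topspace X) y" if y: "y \<in> topspace X" for y
  proof -
    have "g y \<in> topspace X"
      using homeomorphic_imp_surjective_map [OF gm] y by blast
    moreover have "inj_on f (topspace X)"
      using fB by (simp add: Bij_def bij_betw_def)
    ultimately show ?thesis
      using inv_into_f_f [of f "topspace X" "g y"] fg [OF y] y by simp
  qed
  then have "homeomorphic_map X X (restrict (inv_into (topspace X) f) (topspace X))"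
    by (rule homeomorphic_map_eq [OF gm])
  then show "inv\<^bsub>BijGroup (topspace X)\<^esub> f \<in> Homeo X"
    by (simp add: inv_BijGroup fB Homeo_def)
next
  fix f g assume f: "f \<in> Homeo X" and g: "g \<in> Homeo X"
  then have B: "f \<in> Bij (topspace X)" "g \<in> Bij (topspace X)"
    using Homeo_subset_Bij by blast+
  have "homeomorphic_map X X (f \<circ> g)"
    using f g homeomorphic_map_compose by (auto simp: Homeo_def)
  then have "homeomorphic_map X X (compose (topspace X) f g)"
    by (rule homeomorphic_map_eq) (simp add: compose_eq)
  then show "f \<otimes>\<^bsub>BijGroup (topspace X)\<^esub> g \<in> Homeo X"
    using B by (simp add: BijGroup_def Homeo_def)
qed

lemma group_Homeo_group: "group (Homeo_group X)"
  unfolding Homeo_group_def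
  by (rule subgroup.subgroup_is_group [OF subgroup_Homeo group_BijGroup])

end

(* Let H be a subgroup of index less than the continuum in the group of increasing homeomorphisms
   of the line. Homeomorphisms with disjoint supports can be multiplied without restriction, so
   every sequence of disjoint sets yields continuum many elements, two of which share a coset of H.
   This shows first that H contains all commutators of homeomorphisms supported in one of infinitely
   many disjoint sets, and then, with a family of pushes indexed by sets of naturals, that for
   disjoint intervals J_k which can be separated from each other, H contains every homeomorphism
   supported in the union of almost all the J_k. Consequently only finitely many points can fail to
   have a neighbourhood U such that H contains the homeomorphisms supported in U. This finite set is
   H-invariant, but H contains nontrivial translations, so it is empty. Overlapping intervals then
   give all compactly supported homeomorphisms, and sequences of intervals going to both ends give
   all the others. On the circle, the line case applies to the stabilizer of each point, and these
   stabilizers generate the orientation preserving homeomorphisms. An index two subgroup contained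
   in every subgroup of small index is the only proper one. *)

theory Submission
  imports Defs
begin

text \<open>\<open>H\<close> is not assumed normal, so intervals can be moved only by conjugating
  with elements of \<open>H\<close>, and such elements come only from two members of a family
  sharing a coset. A family must therefore be such that the quotient of any two of its members is
  useful, on almost all intervals at once. Choosing 0 or 1 pushes on each interval would not do: the
  differences of exponents could vanish or change sign infinitely often. Reading sets of naturals as
  binary expansions and comparing prefixes prevents this. Commutators suffice because a
  homeomorphism whose support has infinitely many disjoint translates inside a larger set is itself
  one commutator of maps living there. The infinite product behind this raises no question of
  convergence, since only order and surjectivity have to be checked.\<close>

section \<open>Increasing homeomorphisms of the line and their supports\<close>

text \<open>A strictly increasing surjection is automatically a homeomorphism. The abbreviation is needed
  because HOL-Algebra uses \<open>inv\<close> for inverses in groups.\<close>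

abbreviation finv :: "(real \<Rightarrow> real) \<Rightarrow> real \<Rightarrow> real" where
  "finv \<equiv> inv_into UNIV"

definition homeo_on :: "real set \<Rightarrow> (real \<Rightarrow> real) set" where
  "homeo_on U = {f. strict_mono f \<and> surj f \<and> (\<forall>x. x \<notin> U \<longrightarrow> f x = x)}"

lemma homeo_onI:
  "(\<And>x y. x < y \<Longrightarrow> f x < f y) \<Longrightarrow> (\<And>y. \<exists>x. f x = y) \<Longrightarrow> (\<And>x. x \<notin> U \<Longrightarrow> f x = x) \<Longrightarrow> f \<in> homeo_on U"
  unfolding homeo_on_def by (auto simp: strict_mono_def surj_def) metis

lemma homeo_on_fix: "f \<in> homeo_on U \<Longrightarrow> x \<notin> U \<Longrightarrow> f x = x"
  by (simp add: homeo_on_def)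

lemma homeo_on_mono: "U \<subseteq> V \<Longrightarrow> homeo_on U \<subseteq> homeo_on V"
  by (auto simp: homeo_on_def)

lemma homeo_on_UNIV: "f \<in> homeo_on U \<Longrightarrow> f \<in> homeo_on UNIV"
  using homeo_on_mono by blast

lemma homeo_on_less: "f \<in> homeo_on U \<Longrightarrow> f x < f y \<longleftrightarrow> x < y"
  by (simp add: homeo_on_def strict_mono_less)

lemma homeo_on_le: "f \<in> homeo_on U \<Longrightarrow> f x \<le> f y \<longleftrightarrow> x \<le> y"
  by (simp add: homeo_on_def strict_mono_less_eq)

lemma homeo_on_eq: "f \<in> homeo_on U \<Longrightarrow> f x = f y \<longleftrightarrow> x = y"
  using strict_mono_eq[of f x y] by (simp add: homeo_on_def)

lemma homeo_on_bij: "f \<in> homeo_on U \<Longrightarrow> bij f"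
  by (simp add: homeo_on_def bij_def strict_mono_imp_inj_on)

lemma homeo_on_inv_f: "f \<in> homeo_on U \<Longrightarrow> finv f (f x) = x"
  by (simp add: homeo_on_bij bij_is_inj)

lemma homeo_on_f_inv: "f \<in> homeo_on U \<Longrightarrow> f (finv f x) = x"
  by (simp add: homeo_on_bij bij_is_surj surj_f_inv_f)

text \<open>A value outside \<open>U\<close> is a fixed point, so by injectivity it is taken only at
  itself.\<close>

lemma homeo_on_mem: "f \<in> homeo_on U \<Longrightarrow> f x \<in> U \<longleftrightarrow> x \<in> U"
  using homeo_on_eq[of f U "f x" x] homeo_on_fix[of f U "f x"] homeo_on_fix[of f U x] by auto

lemma id_homeo_on: "id \<in> homeo_on U"
  by (auto intro: homeo_onI)

lemma comp_homeo_on: "f \<in> homeo_on U \<Longrightarrow> g \<in> homeo_on U \<Longrightarrow> f \<circ> g \<in> homeo_on U"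
  unfolding homeo_on_def using comp_surj[of g f] by (auto simp: strict_mono_def)

lemma inv_homeo_on:
  assumes f: "f \<in> homeo_on U" shows "finv f \<in> homeo_on U"
proof (rule homeo_onI)
  show "finv f x < finv f y" if "x < y" for x y
    using that homeo_on_less[OF f, of "finv f x" "finv f y"] by (simp add: homeo_on_f_inv[OF f])
  show "\<exists>x. finv f x = y" for y
    using homeo_on_inv_f[OF f] by (rule exI)
  show "finv f x = x" if "x \<notin> U" for x
    using homeo_on_fix[OF f that] homeo_on_inv_f[OF f, of x] by simp
qed

lemma inv_homeo_on_mem: "f \<in> homeo_on U \<Longrightarrow> finv f x \<in> U \<longleftrightarrow> x \<in> U"
  by (simp add: homeo_on_mem inv_homeo_on)

lemma inv_homeo_on_eq_iff: "f \<in> homeo_on U \<Longrightarrow> finv f x = y \<longleftrightarrow> x = f y"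
  using homeo_on_f_inv[of f U x] homeo_on_inv_f[of f U y] by auto

lemma inv_comp_homeo_on:
  assumes "f \<in> homeo_on U" "g \<in> homeo_on U" shows "finv (f \<circ> g) = finv g \<circ> finv f"
  using assms by (simp add: homeo_on_bij o_inv_distrib)

lemma inv_inv_homeo_on: "f \<in> homeo_on U \<Longrightarrow> finv (finv f) = f"
  by (simp add: homeo_on_bij inv_inv_eq)

lemma conj_homeo_on:
  assumes h: "h \<in> homeo_on UNIV" and f: "f \<in> homeo_on U" and V: "\<And>x. x \<in> U \<Longrightarrow> h x \<in> V"
  shows "h \<circ> f \<circ> finv h \<in> homeo_on V"
proof -
  have "h \<circ> f \<circ> finv h \<in> homeo_on UNIV"
    using assms by (intro comp_homeo_on inv_homeo_on) (auto intro: homeo_on_UNIV)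
  moreover have "(h \<circ> f \<circ> finv h) x = x" if "x \<notin> V" for x
    
  proof -
    have "finv h x \<notin> U" using V that homeo_on_f_inv[OF h, of x] by metis
    then show ?thesis using homeo_on_fix[OF f] homeo_on_f_inv[OF h, of x] by simp
  qed
  ultimately show ?thesis by (simp add: homeo_on_def)
qed

lemma funpow_homeo_on: "f \<in> homeo_on U \<Longrightarrow> f ^^ n \<in> homeo_on U"
  by (induction n) (auto simp: id_homeo_on[unfolded id_def] comp_homeo_on id_homeo_on)

lemma max_homeo_on:
  assumes "f \<in> homeo_on UNIV" "g \<in> homeo_on UNIV"
  shows "(\<lambda>x. max (f x) (g x)) \<in> homeo_on UNIV"
proof (rule homeo_onI)
  show "max (f x) (g x) < max (f y) (g y)" if "x < y" for x y
    using that homeo_on_less[OF assms(1), of x y] homeo_on_less[OF assms(2), of x y] by auto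
  show "\<exists>x. max (f x) (g x) = y" for y
  \<comment> \<open>The maximum reaches \<open>y\<close> at the first point where one of the two
    maps does.\<close>
  proof (rule exI[of _ "min (finv f y) (finv g y)"])
    show "max (f (min (finv f y) (finv g y))) (g (min (finv f y) (finv g y))) = y"
      using homeo_on_le[OF assms(1), of "finv g y" "finv f y"] homeo_on_le[OF assms(2), of "finv f y" "finv g y"]
      by (auto simp: min_def max_def homeo_on_f_inv[OF assms(1)] homeo_on_f_inv[OF assms(2)])
  qed
qed simp

lemma min_homeo_on:
  assumes "f \<in> homeo_on UNIV" "g \<in> homeo_on UNIV"
  shows "(\<lambda>x. min (f x) (g x)) \<in> homeo_on UNIV"
proof (rule homeo_onI)
  show "min (f x) (g x) < min (f y) (g y)" if "x < y" for x y
    using that homeo_on_less[OF assms(1), of x y] homeo_on_less[OF assms(2), of x y] by auto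
  show "\<exists>x. min (f x) (g x) = y" for y
  proof (rule exI[of _ "max (finv f y) (finv g y)"])
    show "min (f (max (finv f y) (finv g y))) (g (max (finv f y) (finv g y))) = y"
      using homeo_on_le[OF assms(1), of "finv g y" "finv f y"] homeo_on_le[OF assms(2), of "finv f y" "finv g y"]
      by (auto simp: min_def max_def homeo_on_f_inv[OF assms(1)] homeo_on_f_inv[OF assms(2)])
  qed
qed simp

lemma homeo_on_push:
  assumes x: "a < x" "x < b" and y: "a < y" "y < b"
  shows "\<exists>g\<in>homeo_on {a<..<b}. g x = y"
proof -
  \<comment> \<open>The piecewise linear map fixing \<open>a\<close> and \<open>b\<close> and taking
    \<open>x\<close> to \<open>y\<close>; exchanging \<open>x\<close> and \<open>y\<close> gives its
    inverse, whence surjectivity.\<close>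
  define P where "P x y t = (if t \<le> a \<or> b \<le> t then t
      else if t \<le> x then a + (t - a) * ((y - a) / (x - a)) else b - (b - t) * ((b - y) / (b - x)))" for x y t :: real
  have lo: "a < a + (t - a) * ((y - a) / (x - a)) \<and> a + (t - a) * ((y - a) / (x - a)) \<le> y"
    if "a < x" "a < y" "a < t" "t \<le> x" for x y t :: real
  proof -
    have "(t - a) * ((y - a) / (x - a)) \<le> (x - a) * ((y - a) / (x - a))"
      using that by (intro mult_right_mono) auto
    moreover have "(t - a) * ((y - a) / (x - a)) > 0" using that by simp
    ultimately show ?thesis using that by simp
  qed
  have hi: "y < b - (b - t) * ((b - y) / (b - x)) \<and> b - (b - t) * ((b - y) / (b - x)) < b"
    if "x < b" "y < b" "x < t" "t < b" for x y t :: real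
  proof -
    have "(b - t) * ((b - y) / (b - x)) < (b - x) * ((b - y) / (b - x))"
      using that by (intro mult_strict_right_mono) auto
    moreover have "(b - t) * ((b - y) / (b - x)) > 0" using that by simp
    ultimately show ?thesis using that by simp
  qed
  have P1: "P x y t = t" if "t \<le> a \<or> b \<le> t" for x y t using that by (simp add: P_def)
  have P2: "P x y t = a + (t - a) * ((y - a) / (x - a))" if "a < t" "t \<le> x" "x < b" for x y t
    using that by (auto simp: P_def)
  have P3: "P x y t = b - (b - t) * ((b - y) / (b - x))" if "x < t" "t < b" "a < x" for x y t
    using that by (auto simp: P_def)
  have inv: "P y x (P x y t) = t" if xy: "a < x" "x < b" "a < y" "y < b" for x y t
  proof -
    consider "t \<le> a \<or> b \<le> t" | "a < t" "t \<le> x" | "x < t" "t < b" by linarith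
    then show ?thesis
    proof cases
      case 1 then show ?thesis by (simp add: P1)
    next
      case 2
      with lo[of x y t] xy show ?thesis by (simp add: P2)
    next
      case 3
      with hi[of x y t] xy show ?thesis by (simp add: P3)
    qed
  qed
  have mono: "P x y s < P x y t" if st: "s < t" for s t
  proof -
    consider "s \<le> a \<or> b \<le> s" | "a < s" "s \<le> x" | "x < s" "s < b" by linarith
    then show ?thesis
    proof cases
      case 1
      have "P x y t > a" if "a < t"
        using that lo[of x y t] hi[of x y t] x y P1[of t x y] P2[of t x y] P3[of x t y] by linarith
      with 1 st show ?thesis by (smt (verit, best) P1)
    next
      case 2
      have "(s - a) * ((y - a) / (x - a)) < (t - a) * ((y - a) / (x - a))"
        using st x y by (intro mult_strict_right_mono) auto
      then show ?thesis
        using 2 lo[of x y s] hi[of x y t] x y st P1[of t x y] P2[of t x y] P3[of x t y] P2[of s x y] by linarith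
    next
      case 3
      have "(b - t) * ((b - y) / (b - x)) < (b - s) * ((b - y) / (b - x))"
        using st x y by (intro mult_strict_right_mono) auto
      then show ?thesis
        using 3 hi[of x y s] x y st P1[of t x y] P3[of x t y] P3[of x s y] by linarith
    qed
  qed
  have "P x y \<in> homeo_on {a<..<b}"
  proof (rule homeo_onI)
    show "\<exists>t. P x y t = s" for s
      using inv[of y x s] x y by blast
  qed (use mono P1 in auto)
  moreover have "P x y x = y" using x by (simp add: P2)
  ultimately show ?thesis by blast
qed

section \<open>Infinite products over disjoint sets, restrictions, and commutators\<close>

definition glue :: "('i \<Rightarrow> real set) \<Rightarrow> ('i \<Rightarrow> real \<Rightarrow> real) \<Rightarrow> real \<Rightarrow> real" where
  "glue U a x = (if \<exists>i. x \<in> U i then a (THE i. x \<in> U i) x else x)"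

lemma glue_eq: "disjoint_family U \<Longrightarrow> x \<in> U i \<Longrightarrow> glue U a x = a i x"
proof -
  assume d: "disjoint_family U" and x: "x \<in> U i"
  then have "(THE i. x \<in> U i) = i"
    by (intro the_equality) (auto simp: disjoint_family_on_def)
  then show ?thesis using x by (auto simp: glue_def)
qed

lemma glue_outside: "(\<And>i. x \<notin> U i) \<Longrightarrow> glue U a x = x"
  by (simp add: glue_def)

lemma glue_homeo_on:
  assumes d: "disjoint_family U" and a: "\<And>i. a i \<in> homeo_on (U i)"
  shows "glue U a \<in> homeo_on (\<Union>i. U i)"
proof (rule homeo_onI)
  have fix_other: "a i y = y" if "y \<in> U j" "i \<noteq> j" for i j y
    using that d a by (intro homeo_on_fix) (auto simp: disjoint_family_on_def)
  show "glue U a x < glue U a y" if "x < y" for x y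
  proof (cases "\<exists>i. x \<in> U i")
    case True
    then obtain i where i: "x \<in> U i" by blast
    show ?thesis
    proof (cases "\<exists>j. y \<in> U j")
      case True
      then obtain j where j: "y \<in> U j" by blast
      show ?thesis
      proof (cases "i = j")
        case True
        then show ?thesis using i j \<open>x < y\<close> d homeo_on_less[OF a] by (simp add: glue_eq)
      next
        case False
        \<comment> \<open>As \<open>a j\<close> fixes \<open>x\<close> and \<open>a i\<close> fixes
          \<open>a j y\<close>, applying the two maps in turn compares values belonging to different
          sets.\<close>
        have "x = a j x" using fix_other[OF i] False by simp
        also have "\<dots> < a j y" using \<open>x < y\<close> homeo_on_less[OF a] by simp
        finally have "a i x < a i (a j y)" using homeo_on_less[OF a] by simp
        also have "a i (a j y) = a j y"
          using fix_other[of "a j y" j i] False j homeo_on_mem[OF a] by simp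
        finally show ?thesis using i j d by (simp add: glue_eq)
      qed
    next
      case False
      then have "a i x < a i y" "a i y = y" "glue U a y = y"
        using \<open>x < y\<close> homeo_on_less[OF a, of i x y] homeo_on_fix[OF a, of y i] glue_outside[of y U] by auto
      then show ?thesis using i d by (simp add: glue_eq)
    qed
  next
    case False
    show ?thesis
    proof (cases "\<exists>j. y \<in> U j")
      case True
      then obtain j where j: "y \<in> U j" by blast
      have "a j x < a j y" "a j x = x" "glue U a x = x"
        using \<open>x < y\<close> homeo_on_less[OF a, of j x y] homeo_on_fix[OF a, of x j] glue_outside[of x U] False by auto
      then show ?thesis using j d by (simp add: glue_eq)
    qed (use False \<open>x < y\<close> in \<open>simp add: glue_outside\<close>)
  qed
  show "\<exists>x. glue U a x = y" for y
  proof (cases "\<exists>i. y \<in> U i")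
    case True
    then obtain i where i: "y \<in> U i" by blast
    then have "finv (a i) y \<in> U i" using inv_homeo_on_mem[OF a] by simp
    then have "glue U a (finv (a i) y) = y" using d by (simp add: glue_eq homeo_on_f_inv[OF a])
    then show ?thesis ..
  qed (use glue_outside[of y U] in blast)
  show "glue U a x = x" if "x \<notin> (\<Union>i. U i)" for x
    using that by (intro glue_outside) auto
qed

text \<open>The hypothesis says that every boundary of \<open>A\<close> is witnessed by a fixed point, so that
  \<open>f\<close> maps \<open>A\<close> to itself.\<close>

lemma restrict_homeo_on:
  assumes f: "f \<in> homeo_on UNIV"
    and sep: "\<And>x y. x \<in> A \<Longrightarrow> y \<notin> A \<Longrightarrow> \<exists>z. f z = z \<and> (x \<le> z \<and> z \<le> y \<or> y \<le> z \<and> z \<le> x)"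
  shows "(\<lambda>x. if x \<in> A then f x else x) \<in> homeo_on A"
proof (rule homeo_onI)
  note less = homeo_on_less[OF f] and le = homeo_on_le[OF f] and eq = homeo_on_eq[OF f]
  show "(if x \<in> A then f x else x) < (if y \<in> A then f y else y)" if "x < y" for x y
  proof -
    have 1: "f x < y" if xy: "x \<in> A" "y \<notin> A"
    proof -
      obtain z where "f z = z" "x \<le> z" "z \<le> y" using sep[OF xy] \<open>x < y\<close> by force
      then show ?thesis using le[of x z] \<open>x < y\<close> less[of x z] by (cases "x = z") auto
    qed
    have 2: "x < f y" if xy: "y \<in> A" "x \<notin> A"
    proof -
      obtain z where "f z = z" "x \<le> z" "z \<le> y" using sep[OF xy] \<open>x < y\<close> by force
      then show ?thesis using le[of z y] \<open>x < y\<close> less[of z y] by (cases "z = y") auto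
    qed
    show ?thesis using 1 2 less[of x y] that by auto
  qed
  show "\<exists>x. (if x \<in> A then f x else x) = y" for y
  proof (cases "y \<in> A")
    case True
    define x where "x = finv f y"
    have y: "y = f x" using f by (simp add: x_def homeo_on_f_inv)
    have "x \<in> A"
    proof (rule ccontr)
      assume "x \<notin> A"
      then obtain z where "f z = z" "y \<le> z \<and> z \<le> x \<or> x \<le> z \<and> z \<le> y"
        using sep True by blast
      then have "x = y" using y le[of x z] le[of z x] eq[of z x] by auto
      then show False using True \<open>x \<notin> A\<close> by simp
    qed
    then show ?thesis using y by auto
  qed auto
qed auto

text \<open>With \<open>F\<close> the infinite product of the conjugates \<open>b\<^sup>n \<circ> f \<circ> b\<^sup>-\<^sup>n\<close>, whose supports are
  disjoint, \<open>F = f \<circ> (b \<circ> F \<circ> b\<^sup>-\<^sup>1)\<close>.\<close>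

lemma commutator_swindle:
  assumes f: "f \<in> homeo_on C" and b: "b \<in> homeo_on W" and "C \<subseteq> W"
    and disj: "\<And>n x. 0 < n \<Longrightarrow> x \<in> C \<Longrightarrow> (b ^^ n) x \<notin> C"
  shows "\<exists>F\<in>homeo_on W. f = F \<circ> b \<circ> finv F \<circ> finv b"
proof -
  define U where "U n = (b ^^ n) ` C" for n
  define a where "a n = b ^^ n \<circ> f \<circ> finv (b ^^ n)" for n
  define F where "F = glue U a"
  note bn = funpow_homeo_on[OF b]
  have le: "m = n" if "x \<in> U m" "x \<in> U n" "m \<le> n" for x m n
  proof (rule ccontr)
    assume "m \<noteq> n"
    then obtain k where k: "n = m + k" "0 < k" using \<open>m \<le> n\<close> by (metis add.right_neutral le_Suc_ex neq0_conv)
    obtain c d where cd: "c \<in> C" "d \<in> C" "x = (b ^^ m) c" "x = (b ^^ n) d"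
      using \<open>x \<in> U m\<close> \<open>x \<in> U n\<close> by (auto simp: U_def)
    then have "(b ^^ m) c = (b ^^ m) ((b ^^ k) d)" by (simp add: k funpow_add)
    then have "c = (b ^^ k) d" by (simp add: homeo_on_eq[OF bn])
    then show False using disj[OF k(2) cd(2)] cd(1) by simp
  qed
  have dU: "disjoint_family U"
    unfolding disjoint_family_on_def using le by (metis disjoint_iff nle_le)
  have UW: "U n \<subseteq> W" for n
    using homeo_on_mem[OF bn[of n]] \<open>C \<subseteq> W\<close> by (auto simp: U_def)
  have aU: "a n \<in> homeo_on (U n)" for n
    unfolding a_def by (rule conj_homeo_on[OF homeo_on_UNIV[OF bn] f]) (auto simp: U_def)
  have FU: "F \<in> homeo_on (\<Union>n. U n)"
    unfolding F_def by (rule glue_homeo_on[OF dU aU])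
  have F: "F \<in> homeo_on W" using FU UW homeo_on_mono[of "\<Union>n. U n" W] by blast
  have Fb: "F ((b ^^ n) c) = (b ^^ n) (f c)" if "c \<in> C" for n c
  proof -
    have "(b ^^ n) c \<in> U n" using that by (simp add: U_def)
    then have "F ((b ^^ n) c) = a n ((b ^^ n) c)" by (simp add: F_def glue_eq[OF dU])
    then show ?thesis by (simp add: a_def homeo_on_inv_f[OF bn])
  qed
  \<comment> \<open>The claim multiplied out. On a translate of \<open>C\<close>, one more
    application of \<open>b\<close> leads off \<open>C\<close>, where \<open>f\<close> is trivial;
    at a point entering \<open>C\<close> from outside the translates, \<open>F\<close> acts as
    \<open>f\<close>.\<close>
  have key: "f (b (F x)) = F (b x)" for x
  proof (cases "x \<in> (\<Union>n. U n)")
    case True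
    then obtain n c where c: "c \<in> C" "x = (b ^^ n) c" by (auto simp: U_def)
    have "b (F x) = (b ^^ Suc n) (f c)" using c by (simp add: Fb)
    moreover have "(b ^^ Suc n) (f c) \<notin> C" using disj[of "Suc n"] c homeo_on_mem[OF f] by blast
    moreover have "F (b x) = (b ^^ Suc n) (f c)" using Fb[OF c(1), of "Suc n"] c by simp
    ultimately show ?thesis using homeo_on_fix[OF f] by simp
  next
    case False
    then have Fx: "F x = x" using homeo_on_fix[OF FU] by blast
    show ?thesis
    proof (cases "b x \<in> C")
      case True
      then show ?thesis using Fb[of "b x" 0] Fx by simp
    next
      case False
      have "b x \<notin> U n" for n
      proof (cases n)
        case 0 then show ?thesis using False by (simp add: U_def)
      next
        case (Suc m)
        show ?thesis
        proof
          assume "b x \<in> U n"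
          then obtain c where "c \<in> C" "b x = b ((b ^^ m) c)" by (auto simp: U_def Suc)
          then have "x \<in> U m" using homeo_on_eq[OF b] by (auto simp: U_def)
          then show False using \<open>x \<notin> (\<Union>n. U n)\<close> by blast
        qed
      qed
      then have "F (b x) = b x" using homeo_on_fix[OF FU] by blast
      then show ?thesis using Fx False homeo_on_fix[OF f] by simp
    qed
  qed
  have "f x = (F \<circ> b \<circ> finv F \<circ> finv b) x" for x
    using key[of "finv F (finv b x)"] by (simp add: homeo_on_f_inv[OF F] homeo_on_f_inv[OF b])
  then have "f = F \<circ> b \<circ> finv F \<circ> finv b" by (rule ext)
  then show ?thesis using F by blast
qed

text \<open>The first step passes \<open>e\<close>, and monotonicity prevents any return. This
  serves both for the disjoint translates in the swindle and for the lower bound on the pushes in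
  \<open>tail_in_H\<close>.\<close>

lemma homeo_on_funpow_expand:
  assumes b: "b \<in> homeo_on W" and e: "c < e" "b c = e" and n: "0 < n" and x: "c \<le> x"
  shows "e \<le> (b ^^ n) x"
  using n
proof (induction n rule: nat_induct_non_zero)
  case 1
  then show ?case using homeo_on_le[OF b, of c x] e x by simp
next
  case (Suc n)
  then show ?case using homeo_on_less[OF b, of c "(b ^^ n) x"] e by simp
qed

lemma disjoint_family_intervals:
  fixes v w :: "'k :: linorder \<Rightarrow> real"
  assumes "\<And>i j. i < j \<Longrightarrow> w i \<le> v j \<or> w j \<le> v i"
  shows "disjoint_family (\<lambda>k. {v k<..<w k})"
  unfolding disjoint_family_on_def
proof (intro ballI impI)
  fix i j :: 'k assume "i \<noteq> j"
  then have "w i \<le> v j \<or> w j \<le> v i" using assms[of i j] assms[of j i] by (metis neqE)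
  then show "{v i<..<w i} \<inter> {v j<..<w j} = {}" by auto
qed

primrec binary_prefix :: "nat set \<Rightarrow> nat \<Rightarrow> nat" where
  "binary_prefix S 0 = 0"
| "binary_prefix S (Suc k) = 2 * binary_prefix S k + of_bool (k \<in> S)"

text \<open>The order is lexicographic: an integer gap of at least 1 becomes at least 2 on doubling,
  and the next digit takes back at most 1.\<close>

lemma binary_prefix_less:
  assumes "binary_prefix S N < binary_prefix T N" "N \<le> k"
  shows "binary_prefix S k < binary_prefix T k"
  using assms(2,1) by (induction k rule: dec_induct) auto

lemma binary_prefix_differ:
  assumes "S \<noteq> T" shows "\<exists>N. binary_prefix S N \<noteq> binary_prefix T N"
proof (rule ccontr)
  assume "\<nexists>N. binary_prefix S N \<noteq> binary_prefix T N"
  then have eq: "binary_prefix S N = binary_prefix T N" for N by blast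
  have "k \<in> S \<longleftrightarrow> k \<in> T" for k
    using eq[of k] eq[of "Suc k"] by (auto split: if_splits simp: of_bool_def)
  then show False using assms by blast
qed

section \<open>Subgroups of small index in the increasing homeomorphisms of the line\<close>

text \<open>The last assumption is what remains of ``index less than the continuum'': among any
  continuum many elements two lie in the same right coset.\<close>

locale small_index_subgroup =
  fixes H :: "(real \<Rightarrow> real) set"
  assumes H_homeo: "h \<in> H \<Longrightarrow> h \<in> homeo_on UNIV"
    and H_comp: "f \<in> H \<Longrightarrow> h \<in> H \<Longrightarrow> f \<circ> h \<in> H"
    and H_inv: "h \<in> H \<Longrightarrow> finv h \<in> H"
    and H_small: "(\<And>S :: nat set. g S \<in> homeo_on UNIV) \<Longrightarrow> \<exists>S T. S \<noteq> T \<and> g S \<circ> finv (g T) \<in> H"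
begin

text \<open>\<open>H_small\<close> for a constant family shows that \<open>H\<close> is
  inhabited.\<close>

lemma H_id: "id \<in> H"
proof -
  obtain h where h: "h \<in> H" using H_small[of "\<lambda>_. id"] id_homeo_on by blast
  have "h \<circ> finv h = id" by (auto simp: homeo_on_f_inv[OF H_homeo[OF h]])
  then show ?thesis using H_comp[OF h H_inv[OF h]] by simp
qed

text \<open>For \<open>h\<close> moving the support of \<open>f\<close> into a set that is already
  under control.\<close>

lemma H_conj_cancel:
  assumes "h \<in> H" "f \<in> homeo_on UNIV" "h \<circ> f \<circ> finv h \<in> H" shows "f \<in> H"
proof -
  have "finv h \<circ> (h \<circ> f \<circ> finv h) \<circ> h \<in> H" using H_comp[OF H_comp[OF H_inv[OF assms(1)] assms(3)] assms(1)] .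
  also have "finv h \<circ> (h \<circ> f \<circ> finv h) \<circ> h = f"
    by (auto simp: homeo_on_inv_f[OF H_homeo[OF \<open>h \<in> H\<close>]])
  finally show ?thesis .
qed

text \<open>For splitting off a factor \<open>h\<close> that agrees with \<open>f\<close> somewhere,
  which leaves a simpler map.\<close>

lemma H_factor:
  assumes "f \<in> homeo_on UNIV" "h \<in> H" "finv h \<circ> f \<in> H" shows "f \<in> H"
proof -
  have "h \<circ> (finv h \<circ> f) \<in> H" using assms(2,3) by (rule H_comp)
  also have "h \<circ> (finv h \<circ> f) = f" by (auto simp: homeo_on_f_inv[OF H_homeo[OF \<open>h \<in> H\<close>]])
  finally show ?thesis .
qed

section \<open>Coset collisions over disjoint supports\<close>

text \<open>If it failed, one bad \<open>a n\<close> on every \<open>U n\<close> would give, by choosing on each \<open>U n\<close> either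
  \<open>a n\<close> or the identity, continuum many elements in distinct cosets.\<close>

lemma extension_in_H:
  fixes U :: "nat \<Rightarrow> real set"
  assumes d: "disjoint_family U"
  shows "\<exists>n. \<forall>a\<in>homeo_on (U n). \<exists>h\<in>H. h \<in> homeo_on (\<Union>i. U i) \<and> (\<forall>x\<in>U n. h x = a x)"
proof (rule ccontr)
  assume "\<not> ?thesis"
  then have "\<forall>n. \<exists>a\<in>homeo_on (U n). \<forall>h\<in>H. h \<in> homeo_on (\<Union>i. U i) \<longrightarrow> (\<exists>x\<in>U n. h x \<noteq> a x)"
    by blast
  then obtain a where a: "\<And>n. a n \<in> homeo_on (U n)"
    and bad: "\<And>n h. h \<in> H \<Longrightarrow> h \<in> homeo_on (\<Union>i. U i) \<Longrightarrow> \<exists>x\<in>U n. h x \<noteq> a n x"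
    by metis
  define c where "c S n = (if n \<in> S then a n else id)" for S n
  define g where "g S = glue U (c S)" for S
  have c: "c S n \<in> homeo_on (U n)" for S n by (simp add: c_def a id_homeo_on)
  have g: "g S \<in> homeo_on (\<Union>i. U i)" for S unfolding g_def by (rule glue_homeo_on[OF d c])
  have gx: "g S x = c S n x" if "x \<in> U n" for S n x unfolding g_def by (rule glue_eq[OF d that])
  \<comment> \<open>On \<open>U n\<close> the quotient equals \<open>a n\<close>, because
    \<open>g T\<close> is trivial there; this contradicts the choice of \<open>a n\<close>.\<close>
  have same: False if h: "g S \<circ> finv (g T) \<in> H" and n: "n \<in> S" "n \<notin> T" for S T n
  proof -
    have "g S \<circ> finv (g T) \<in> homeo_on (\<Union>i. U i)" by (intro comp_homeo_on inv_homeo_on g)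
    then obtain x where x: "x \<in> U n" "(g S \<circ> finv (g T)) x \<noteq> a n x" using bad[OF h] by blast
    have "g T x = x" using gx[OF x(1)] n by (simp add: c_def)
    then have "finv (g T) x = x" by (metis homeo_on_inv_f[OF g])
    then show False using x gx[OF x(1), of S] n by (simp add: c_def)
  qed
  obtain S T where ST: "S \<noteq> T" "g S \<circ> finv (g T) \<in> H"
    using H_small[of g] homeo_on_UNIV[OF g] by blast
  have "finv (g S \<circ> finv (g T)) = g T \<circ> finv (g S)"
    using inv_comp_homeo_on[OF g inv_homeo_on[OF g]] inv_inv_homeo_on[OF g] by simp
  then have "g T \<circ> finv (g S) \<in> H" using H_inv[OF ST(2)] by simp
  then show False using same ST by blast
qed

text \<open>A row of the array and a transversal of the rows meet in one cell only, so extensions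
  in \<open>H\<close> along these two sets have their commutator supported in that cell.\<close>

lemma commutators_in_H:
  fixes U :: "nat \<times> nat \<Rightarrow> real set"
  assumes d: "disjoint_family U"
  shows "\<exists>n. \<forall>a\<in>homeo_on (U n). \<forall>b\<in>homeo_on (U n). a \<circ> b \<circ> finv a \<circ> finv b \<in> H"
proof -
  have disj: "n = m" if "x \<in> U n" "x \<in> U m" for x n m
    using d that by (metis UNIV_I disjoint_family_onD disjoint_iff)
  have "\<exists>j. \<forall>a\<in>homeo_on (U (i, j)). \<exists>h\<in>H. h \<in> homeo_on (\<Union>j. U (i, j)) \<and> (\<forall>x\<in>U (i, j). h x = a x)" for i
    by (rule extension_in_H) (use disj in \<open>fastforce simp: disjoint_family_on_def\<close>)
  then obtain J where J: "\<And>i a. a \<in> homeo_on (U (i, J i)) \<Longrightarrow>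
      \<exists>h\<in>H. h \<in> homeo_on (\<Union>j. U (i, j)) \<and> (\<forall>x\<in>U (i, J i). h x = a x)"
    by metis
  obtain i where i: "\<And>b. b \<in> homeo_on (U (i, J i)) \<Longrightarrow>
      \<exists>h\<in>H. h \<in> homeo_on (\<Union>i. U (i, J i)) \<and> (\<forall>x\<in>U (i, J i). h x = b x)"
    using extension_in_H[of "\<lambda>i. U (i, J i)"] disj by (fastforce simp: disjoint_family_on_def)
  define V where "V = U (i, J i)"
  have "a \<circ> b \<circ> finv a \<circ> finv b \<in> H" if a: "a \<in> homeo_on V" and b: "b \<in> homeo_on V" for a b
  proof -
    define R where "R = (\<Union>j. U (i, j))"
    define D where "D = (\<Union>i. U (i, J i))"
    obtain g where g: "g \<in> H" "g \<in> homeo_on R" "\<And>x. x \<in> V \<Longrightarrow> g x = a x"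
      using J a unfolding V_def R_def by blast
    obtain h where h: "h \<in> H" "h \<in> homeo_on D" "\<And>x. x \<in> V \<Longrightarrow> h x = b x"
      using i b unfolding V_def D_def by blast
    have RD: "x \<in> V" if "x \<in> R" "x \<in> D" for x
      using that disj unfolding R_def D_def V_def by fastforce
    have gV: "finv g x = finv a x" if "x \<in> V" for x
      using that inv_homeo_on_mem[OF a] g(3)[of "finv a x"] 
      by (simp add: inv_homeo_on_eq_iff[OF g(2)] homeo_on_f_inv[OF a])
    have hV: "finv h x = finv b x" if "x \<in> V" for x
      using that inv_homeo_on_mem[OF b] h(3)[of "finv b x"] 
      by (simp add: inv_homeo_on_eq_iff[OF h(2)] homeo_on_f_inv[OF b])
    have gVi: "finv g x \<in> V \<longleftrightarrow> x \<in> V" for x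
      using gV inv_homeo_on_mem[OF a] homeo_on_mem[OF a] g(3) homeo_on_f_inv[OF g(2)] by metis
    have hVi: "finv h x \<in> V \<longleftrightarrow> x \<in> V" for x
      using hV inv_homeo_on_mem[OF b] homeo_on_mem[OF b] h(3) homeo_on_f_inv[OF h(2)] by metis
    note gR = homeo_on_fix[OF inv_homeo_on[OF g(2)]] homeo_on_fix[OF g(2)] inv_homeo_on_mem[OF g(2)]
    note hD = homeo_on_fix[OF inv_homeo_on[OF h(2)]] homeo_on_fix[OF h(2)] inv_homeo_on_mem[OF h(2)]
    have "(g \<circ> h \<circ> finv g \<circ> finv h) x = (a \<circ> b \<circ> finv a \<circ> finv b) x" for x
    proof (cases "x \<in> V")
      case True
      then show ?thesis
        by (simp add: hV gV g h inv_homeo_on_mem[OF a] inv_homeo_on_mem[OF b] homeo_on_mem[OF b])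
    next
      case False
      have "(a \<circ> b \<circ> finv a \<circ> finv b) x = x"
        using homeo_on_fix[OF comp_homeo_on[OF comp_homeo_on[OF comp_homeo_on[OF a b]
            inv_homeo_on[OF a]] inv_homeo_on[OF b]]] False by blast
      \<comment> \<open>Off \<open>V\<close> the sets \<open>R\<close> and \<open>D\<close> are
        disjoint, and both maps preserve \<open>V\<close>; so at most one of \<open>g\<close> and
        \<open>h\<close> acts there and the commutator cancels.\<close>
      moreover have "(g \<circ> h \<circ> finv g \<circ> finv h) x = x"
      proof (cases "x \<in> D")
        case True
        then have "x \<notin> R" "finv h x \<notin> R" using False RD hVi hD(3) by blast+
        then show ?thesis by (simp add: gR homeo_on_f_inv[OF h(2)])
      next
        case False
        then have "finv h x = x" by (simp add: hD)
        moreover have "finv g x \<notin> D"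
          using False RD gVi \<open>x \<notin> V\<close> gR by (metis)
        ultimately show ?thesis by (simp add: hD homeo_on_f_inv[OF g(2)])
      qed
      ultimately show ?thesis by simp
    qed
    then have "a \<circ> b \<circ> finv a \<circ> finv b = g \<circ> h \<circ> finv g \<circ> finv h" by (intro ext) simp
    then show ?thesis using g(1) h(1) by (simp add: H_comp H_inv)
  qed
  then show ?thesis unfolding V_def by blast
qed

text \<open>The result of \<open>commutators_in_H\<close> provides intervals \<open>{c k..d k}\<close> to the right of the given ones
  on whose union every homeomorphism is in \<open>H\<close>. On the \<open>k\<close>-th interval let \<open>G S\<close> be the power of a
  push \<open>g k\<close> with exponent \<open>binary_prefix S (\<iota> k)\<close>. For two sets in the same coset the difference of the
  exponents has eventually constant nonzero sign, so an element of \<open>H\<close> pushes almost all the given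
  intervals into the \<open>{c k..d k}\<close> simultaneously.\<close>

lemma tail_in_H:
  fixes v p q w :: "'k \<Rightarrow> real" and \<iota> :: "'k \<Rightarrow> nat"
  assumes vpqw: "\<And>k. v k < p k" "\<And>k. p k < q k" "\<And>k. q k < w k"
    and dV: "disjoint_family (\<lambda>k. {v k<..<w k})"
  shows "\<exists>N. homeo_on (\<Union>k\<in>{k. N \<le> \<iota> k}. {p k<..<q k}) \<subseteq> H"
proof -
  \<comment> \<open>Points increasing from the midpoint of \<open>q k\<close> and \<open>w k\<close>
    towards \<open>w k\<close>. Uniting the gaps \<open>I n k\<close> over \<open>k\<close> gives
    infinitely many disjoint sets, each of them present for every \<open>k\<close>.\<close>
  define u where "u n k = w k - (w k - q k) / (real n + 2)" for n k
  have u_less: "u m k < u n k" if "m < n" for m n k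
    using that vpqw(3)[of k] by (auto simp: u_def intro!: divide_strict_left_mono mult_pos_pos)
  have u_le: "u m k \<le> u n k" if "m \<le> n" for m n k
    using u_less[of m n k] that by (cases "m = n") auto
  have uq: "q k < u n k" for n k
  proof -
    have "(w k - q k) / (real n + 2) < (w k - q k) / 1"
      using vpqw(3)[of k] by (intro divide_strict_left_mono) auto
    then show ?thesis by (simp add: u_def)
  qed
  have uw: "u n k < w k" for n k
    using vpqw(3)[of k] by (simp add: u_def)
  define I where "I n k = {u n k<..<u (Suc n) k}" for n k
  have IV: "I n k \<subseteq> {v k<..<w k}" for n k
    using uq[of k n] uw[of "Suc n" k] vpqw[of k] by (force simp: I_def)
  have dI: "n = m \<and> k = j" if "x \<in> I n k" "x \<in> I m j" for x n m k j
  proof -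
    have "x \<in> {v k<..<w k} \<inter> {v j<..<w j}" using that IV by blast
    then have kj: "k = j" using disjoint_family_onD[OF dV, of k j] by blast
    moreover have "n = m"
    proof (rule ccontr)
      assume "n \<noteq> m"
      then consider "Suc n \<le> m" | "Suc m \<le> n" by linarith
      then show False
        using that kj u_le[of "Suc n" m k] u_le[of "Suc m" n k] by cases (auto simp: I_def)
    qed
    ultimately show ?thesis by simp
  qed
  have "disjoint_family (\<lambda>z. \<Union>k. I (prod_encode z) k)"
    unfolding disjoint_family_on_def using dI by (fastforce simp: prod_encode_eq)
  then obtain z where z: "\<And>a b. a \<in> homeo_on (\<Union>k. I (prod_encode z) k) \<Longrightarrow>
      b \<in> homeo_on (\<Union>k. I (prod_encode z) k) \<Longrightarrow> a \<circ> b \<circ> finv a \<circ> finv b \<in> H"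
    using commutators_in_H by metis
  define n where "n = prod_encode z"
  define s where "s k = u (Suc n) k - u n k" for k
  have s: "0 < s k" for k using u_less[of n "Suc n" k] by (simp add: s_def)
  \<comment> \<open>Quarter points of the chosen gap. A push of \<open>c k\<close> to
    \<open>e k\<close>, beyond \<open>d k\<close>, makes all positive powers move \<open>C\<close>
    off itself, as \<open>commutator_swindle\<close> requires.\<close>
  define c d e where "c k = u n k + s k / 4" and "d k = u n k + s k / 2" and "e k = u n k + 3 * s k / 4" for k
  have ord: "u n k < c k" "c k < d k" "d k < e k" "e k < u (Suc n) k" for k
    using s[of k] s_def[of k] unfolding c_def d_def e_def by linarith+
  define C where "C = (\<Union>k. {c k..d k})"
  have dJ: "disjoint_family (I n)" unfolding disjoint_family_on_def using dI by blast
  have CI: "{c k..d k} \<subseteq> I n k" for k using ord[of k] by (auto simp: I_def)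
  have "\<exists>b\<in>homeo_on (I n k). b (c k) = e k" for k
    unfolding I_def using ord[of k] by (intro homeo_on_push) auto
  then obtain b where b: "\<And>k. b k \<in> homeo_on (I n k)" "\<And>k. b k (c k) = e k" by metis
  define \<beta> where "\<beta> = glue (I n) b"
  have \<beta>: "\<beta> \<in> homeo_on (\<Union>k. I n k)" unfolding \<beta>_def by (rule glue_homeo_on[OF dJ b(1)])
  have \<beta>I: "\<beta> x = b k x" if "x \<in> I n k" for x k unfolding \<beta>_def by (rule glue_eq[OF dJ that])
  have \<beta>pow: "(\<beta> ^^ m) x = (b k ^^ m) x \<and> (b k ^^ m) x \<in> I n k" if "x \<in> I n k" for x k m
    using that by (induction m) (auto simp: \<beta>I homeo_on_mem[OF b(1)])
  have C_in_H: "f \<in> H" if f: "f \<in> homeo_on C" for f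
  proof -
    have CW: "C \<subseteq> (\<Union>k. I n k)" using CI unfolding C_def by blast
    have "(\<beta> ^^ m) x \<notin> C" if "0 < m" "x \<in> C" for m x
    proof -
      obtain k where k: "x \<in> {c k..d k}" using \<open>x \<in> C\<close> by (auto simp: C_def)
      have "e k \<le> (b k ^^ m) x"
        using homeo_on_funpow_expand[OF b(1) _ b(2), of k m x] ord[of k] k \<open>0 < m\<close> by auto
      moreover have xI: "x \<in> I n k" using k CI by blast
      have pow: "(\<beta> ^^ m) x = (b k ^^ m) x" "(\<beta> ^^ m) x \<in> I n k" using \<beta>pow[OF xI, of m] by auto
      moreover have "(\<beta> ^^ m) x \<in> {c k..d k}" if "(\<beta> ^^ m) x \<in> C"
      proof -
        obtain j where j: "(\<beta> ^^ m) x \<in> {c j..d j}" using \<open>(\<beta> ^^ m) x \<in> C\<close> unfolding C_def by blast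
        then have "(\<beta> ^^ m) x \<in> I n j" using CI by blast
        then show ?thesis using dI[OF pow(2)] j by blast
      qed
      ultimately show ?thesis using ord[of k] pow(1) by force
    qed
    then have "\<exists>F\<in>homeo_on (\<Union>k. I n k). f = F \<circ> \<beta> \<circ> finv F \<circ> finv \<beta>"
      by (intro commutator_swindle[OF f \<beta> CW])
    then obtain F where "F \<in> homeo_on (\<Union>k. I n k)" "f = F \<circ> \<beta> \<circ> finv F \<circ> finv \<beta>" by (rule bexE)
    then show ?thesis using z[of F \<beta>] \<beta> by (simp add: n_def)
  qed
  \<comment> \<open>Every positive power is bounded below on the interval by \<open>c k\<close>, the
    image of \<open>p k\<close>, and above by \<open>d k\<close>, the end of the support. So only
    the sign of the exponent will matter.\<close>
  have "\<exists>g\<in>homeo_on {v k<..<d k}. g (p k) = c k" for k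
    using ord[of k] vpqw[of k] uq[of k n] by (intro homeo_on_push) auto
  then obtain g where g: "\<And>k. g k \<in> homeo_on {v k<..<d k}" "\<And>k. g k (p k) = c k" by metis
  have dw: "d k < w k" for k using ord[of k] uw[of "Suc n" k] by linarith
  define G where "G S = glue (\<lambda>k. {v k<..<w k}) (\<lambda>k. g k ^^ binary_prefix S (\<iota> k))" for S
  have gV: "g k ^^ m \<in> homeo_on {v k<..<w k}" for k m
  proof (rule funpow_homeo_on)
    have "{v k<..<d k} \<subseteq> {v k<..<w k}" using dw[of k] by auto
    then show "g k \<in> homeo_on {v k<..<w k}" using g(1)[of k] homeo_on_mono by blast
  qed
  have G: "G S \<in> homeo_on UNIV" for S
    unfolding G_def by (rule homeo_on_UNIV[OF glue_homeo_on[OF dV gV]])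
  have GV: "G S x = (g k ^^ binary_prefix S (\<iota> k)) x" if "x \<in> {v k<..<w k}" for S x k
    unfolding G_def by (rule glue_eq[OF dV that])
  have "\<exists>h\<in>H. \<exists>N. \<forall>k. N \<le> \<iota> k \<longrightarrow> (\<forall>x\<in>{p k<..<q k}. h x \<in> {c k..d k})"
  proof -
    obtain S T where ST: "S \<noteq> T" "G S \<circ> finv (G T) \<in> H" using H_small[of G] G by blast
    \<comment> \<open>Exchanging the two sets, and inverting the quotient, makes the sign
      positive.\<close>
    obtain S T N where h: "G S \<circ> finv (G T) \<in> H"
      and N: "\<And>k. N \<le> k \<Longrightarrow> binary_prefix T k < binary_prefix S k"
    proof -
      obtain N where "binary_prefix S N \<noteq> binary_prefix T N" using binary_prefix_differ[OF ST(1)] by blast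
      then consider "binary_prefix S N < binary_prefix T N" | "binary_prefix T N < binary_prefix S N" by linarith
      then show thesis
      proof cases
        case 1
        have "finv (G S \<circ> finv (G T)) = G T \<circ> finv (G S)"
          using inv_comp_homeo_on[OF G inv_homeo_on[OF G]] inv_inv_homeo_on[OF G] by simp
        then have "G T \<circ> finv (G S) \<in> H" using H_inv[OF ST(2)] by simp
        then show thesis using that 1 binary_prefix_less by blast
      next
        case 2
        then show thesis using that ST(2) binary_prefix_less by blast
      qed
    qed
    have "(G S \<circ> finv (G T)) x \<in> {c k..d k}" if k: "N \<le> \<iota> k" and x: "x \<in> {p k<..<q k}" for k x
    proof -
      have xV: "x \<in> {v k<..<w k}" using x vpqw[of k] by auto
      define y where "y = finv (g k ^^ binary_prefix T (\<iota> k)) x"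
      have yV: "y \<in> {v k<..<w k}" using xV inv_homeo_on_mem[OF gV] by (simp add: y_def)
      have gy: "(g k ^^ binary_prefix T (\<iota> k)) y = x" by (simp add: y_def homeo_on_f_inv[OF gV])
      then have "finv (G T) x = y"
        using GV[OF yV, of T] by (simp add: inv_homeo_on_eq_iff[OF G])
      then have eq: "(G S \<circ> finv (G T)) x = (g k ^^ binary_prefix S (\<iota> k)) y"
        using GV[OF yV, of S] by simp
      obtain m where m: "binary_prefix S (\<iota> k) = m + binary_prefix T (\<iota> k)" "0 < m"
        using N[OF k] by (metis add.commute less_imp_add_positive)
      have "(g k ^^ binary_prefix S (\<iota> k)) y = (g k ^^ m) x"
        by (simp add: m funpow_add gy)
      moreover have "c k \<le> (g k ^^ m) x"
        using homeo_on_funpow_expand[OF g(1) _ g(2) m(2), of k x] x ord[of k] uq[of k n] vpqw[of k] by auto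
      moreover have "(g k ^^ m) x \<in> {v k<..<d k}"
        using x ord[of k] uq[of k n] vpqw[of k] by (subst homeo_on_mem[OF funpow_homeo_on[OF g(1)]]) auto
      ultimately show ?thesis using eq by auto
    qed
    then show ?thesis using h by blast
  qed
  then obtain h N where h: "h \<in> H" and hC: "\<And>k x. N \<le> \<iota> k \<Longrightarrow> x \<in> {p k<..<q k} \<Longrightarrow> h x \<in> {c k..d k}"
    by blast
  have "f \<in> H" if f: "f \<in> homeo_on (\<Union>k\<in>{k. N \<le> \<iota> k}. {p k<..<q k})" for f
  proof (rule H_conj_cancel[OF h homeo_on_UNIV[OF f]])
    show "h \<circ> f \<circ> finv h \<in> H"
      by (rule C_in_H, rule conj_homeo_on[OF H_homeo[OF h] f]) (use hC in \<open>auto simp: C_def\<close>)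
  qed
  then show ?thesis by blast
qed

section \<open>Points without a good neighbourhood\<close>

definition bad_points :: "real set" where
  "bad_points = {x. \<forall>a b. a < x \<longrightarrow> x < b \<longrightarrow> \<not> homeo_on {a<..<b} \<subseteq> H}"

text \<open>The tail provided by \<open>tail_in_H\<close> contains at least one of the intervals,
  and the homeomorphisms supported in that one are among those of the union.\<close>

lemma not_all_bad:
  fixes t :: "nat \<Rightarrow> real"
  assumes t: "\<And>k. v k < t k" "\<And>k. t k < w k" and d: "disjoint_family (\<lambda>k. {v k<..<w k})"
  shows "\<exists>k. t k \<notin> bad_points"
proof -
  define p q where "p k = (v k + t k) / 2" and "q k = (t k + w k) / 2" for k
  have pq: "v k < p k" "p k < t k" "t k < q k" "q k < w k" for k
    using t[of k] by (auto simp: p_def q_def)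
  have "p k < q k" for k using pq[of k] by linarith
  then obtain N where N: "homeo_on (\<Union>k\<in>{k. N \<le> id k}. {p k<..<q k}) \<subseteq> H"
    using tail_in_H[of v p q w id] pq d by blast
  have "homeo_on {p N<..<q N} \<subseteq> homeo_on (\<Union>k\<in>{k. N \<le> id k}. {p k<..<q k})"
    by (rule homeo_on_mono) auto
  then show ?thesis using N pq[of N] unfolding bad_points_def by blast
qed

text \<open>An infinite set of reals contains a strictly monotone sequence, and the midpoints
  between neighbours give its terms disjoint intervals. The first term is dropped because it has
  only one neighbour.\<close>

lemma finite_bad_points: "finite bad_points"
proof (rule ccontr)
  assume "infinite bad_points"
  then obtain s :: "nat \<Rightarrow> real" where s: "inj s" "range s \<subseteq> bad_points"
    using infinite_countable_subset by blast
  obtain \<phi> where \<phi>: "strict_mono \<phi>" "monoseq (\<lambda>n. s (\<phi> n))" using seq_monosub by blast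
  define t where "t n = s (\<phi> n)" for n
  have bad: "t n \<in> bad_points" for n using s by (auto simp: t_def)
  have inj: "t m = t n \<longleftrightarrow> m = n" for m n
    using s(1) \<phi>(1) by (simp add: t_def inj_eq strict_mono_eq)
  consider "\<And>m n. m < n \<Longrightarrow> t m < t n" | "\<And>m n. m < n \<Longrightarrow> t n < t m"
    using \<phi>(2) inj unfolding monoseq_def t_def[symmetric] by (metis less_imp_le_nat order.order_iff_strict nat_less_le)
  then show False
  proof cases
    case 1
    then have le: "t m \<le> t n" if "m \<le> n" for m n using that by (cases "m = n") (auto simp: less_imp_le)
    have "\<exists>k. t (Suc k) \<notin> bad_points"
    proof (rule not_all_bad)
      show "(t k + t (Suc k)) / 2 < t (Suc k)" "t (Suc k) < (t (Suc k) + t (Suc (Suc k))) / 2" for k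
        using 1[of k "Suc k"] 1[of "Suc k" "Suc (Suc k)"] by auto
      show "disjoint_family (\<lambda>k. {(t k + t (Suc k)) / 2<..<(t (Suc k) + t (Suc (Suc k))) / 2})"
      proof (intro disjoint_family_intervals disjI1)
        show "(t (Suc i) + t (Suc (Suc i))) / 2 \<le> (t j + t (Suc j)) / 2" if "i < j" for i j
          using that le[of "Suc i" j] le[of "Suc (Suc i)" "Suc j"] by simp
      qed
    qed
    then show False using bad by blast
  next
    case 2
    then have le: "t n \<le> t m" if "m \<le> n" for m n using that by (cases "m = n") (auto simp: less_imp_le)
    have "\<exists>k. t (Suc k) \<notin> bad_points"
    proof (rule not_all_bad)
      show "(t (Suc k) + t (Suc (Suc k))) / 2 < t (Suc k)" "t (Suc k) < (t k + t (Suc k)) / 2" for k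
        using 2[of k "Suc k"] 2[of "Suc k" "Suc (Suc k)"] by auto
      show "disjoint_family (\<lambda>k. {(t (Suc k) + t (Suc (Suc k))) / 2<..<(t k + t (Suc k)) / 2})"
      proof (intro disjoint_family_intervals disjI2)
        show "(t j + t (Suc j)) / 2 \<le> (t (Suc i) + t (Suc (Suc i))) / 2" if "i < j" for i j
          using that le[of "Suc i" j] le[of "Suc (Suc i)" "Suc j"] by simp
      qed
    qed
    then show False using bad by blast
  qed
qed

lemma bad_points_invariant:
  assumes h: "h \<in> H" and x: "x \<in> bad_points" shows "h x \<in> bad_points"
  unfolding bad_points_def
proof (intro CollectI allI impI notI)
  fix a b assume ab: "a < h x" "h x < b" "homeo_on {a<..<b} \<subseteq> H"
  note h' = H_homeo[OF h]
  have "homeo_on {finv h a<..<finv h b} \<subseteq> H"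
  proof
    fix f assume f: "f \<in> homeo_on {finv h a<..<finv h b}"
    have "h y \<in> {a<..<b}" if "y \<in> {finv h a<..<finv h b}" for y
      using that homeo_on_less[OF h', of "finv h a" y] homeo_on_less[OF h', of y "finv h b"]
      by (simp add: homeo_on_f_inv[OF h'])
    then have "h \<circ> f \<circ> finv h \<in> H" using ab(3) conj_homeo_on[OF h' f] by blast
    then show "f \<in> H" using H_conj_cancel[OF h homeo_on_UNIV[OF f]] by blast
  qed
  moreover have "finv h a < x" "x < finv h b"
    using ab homeo_on_less[OF h', of "finv h a" x] homeo_on_less[OF h', of x "finv h b"]
    by (auto simp: homeo_on_f_inv[OF h'])
  ultimately show False using x unfolding bad_points_def by blast
qed

lemma bad_points_empty: "bad_points = {}"
proof (rule ccontr)
  assume "bad_points \<noteq> {}"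
  then obtain x where x: "x \<in> bad_points" by blast
  \<comment> \<open>There are as many reals as sets of naturals, so translations form an admissible
    family. Two in one coset put a nonzero translation into \<open>H\<close>, whose orbit of
    \<open>x\<close> would consist of infinitely many bad points.\<close>
  obtain r :: "nat set \<Rightarrow> real" where r: "inj r"
    using nat_sets_eqpoll_reals by (auto simp: eqpoll_def bij_betw_def)
  define g where "g S = (\<lambda>x. x + r S)" for S
  have g: "g S \<in> homeo_on UNIV" for S
  proof (rule homeo_onI)
    show "\<exists>x. g S x = y" for y by (rule exI[of _ "y - r S"]) (simp add: g_def)
  qed (auto simp: g_def)
  obtain S T where ST: "S \<noteq> T" "g S \<circ> finv (g T) \<in> H" using H_small[of g] g by blast
  define d where "d = r S - r T"
  have "d \<noteq> 0" using r ST by (auto simp: d_def inj_eq)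
  have "finv (g T) y = y - r T" for y
    by (simp add: inv_homeo_on_eq_iff[OF g]) (simp add: g_def)
  then have shift: "(g S \<circ> finv (g T)) y = y + d" for y by (simp add: g_def d_def)
  have "x + real n * d \<in> bad_points" for n
  proof (induction n)
    case (Suc n)
    have "(g S \<circ> finv (g T)) (x + real n * d) \<in> bad_points" by (rule bad_points_invariant[OF ST(2) Suc])
    then show ?case unfolding shift by (simp add: algebra_simps)
  qed (use x in simp)
  then have "range (\<lambda>n. x + real n * d) \<subseteq> bad_points" by blast
  moreover have "inj (\<lambda>n. x + real n * d)" using \<open>d \<noteq> 0\<close> by (auto simp: inj_def)
  ultimately show False using finite_bad_points finite_subset range_inj_infinite by blast
qed

section \<open>From good neighbourhoods to the whole line\<close>

text \<open>Fragmentation: once a point \<open>x\<close> of the overlap is fixed, the map is the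
  product of its parts to the left and to the right of \<open>x\<close>, each supported in one of
  the intervals.\<close>

lemma overlapping_intervals_in_H:
  assumes ab: "homeo_on {a<..<b} \<subseteq> H" and cd: "homeo_on {c<..<d} \<subseteq> H"
    and ord: "a \<le> c" "c < b" "b \<le> d"
  shows "homeo_on {a<..<d} \<subseteq> H"
proof
  fix f assume f: "f \<in> homeo_on {a<..<d}"
  define x where "x = (c + b) / 2"
  have x: "c < x" "x < b" using ord by (auto simp: x_def)
  have fx: "a < f x" "f x < d" using homeo_on_mem[OF f, of x] x ord by auto
  have sub: "homeo_on {a<..<b} \<subseteq> homeo_on {a<..<d}"
    by (rule homeo_on_mono) (use ord in auto)
  have sub': "homeo_on {c<..<d} \<subseteq> homeo_on {a<..<d}"
    by (rule homeo_on_mono) (use ord in auto)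
  \<comment> \<open>One of the two intervals contains both \<open>x\<close> and \<open>f x\<close>,
    and a push inside it is in \<open>H\<close>.\<close>
  have "\<exists>g\<in>H. g \<in> homeo_on {a<..<d} \<and> g (f x) = x"
  proof (cases "f x < b")
    case True
    then obtain g where "g \<in> homeo_on {a<..<b}" "g (f x) = x"
      using homeo_on_push[of a "f x" b x] x fx ord by auto
    then show ?thesis using ab sub by blast
  next
    case False
    then obtain g where "g \<in> homeo_on {c<..<d}" "g (f x) = x"
      using homeo_on_push[of c "f x" d x] x fx ord by auto
    then show ?thesis using cd sub' by blast
  qed
  then obtain g where g: "g \<in> H" "g \<in> homeo_on {a<..<d}" "g (f x) = x" by blast
  define k where "k = g \<circ> f"
  have k: "k \<in> homeo_on {a<..<d}" "k x = x" using comp_homeo_on[OF g(2) f] g(3) by (auto simp: k_def)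
  define l where "l = (\<lambda>y. if y \<in> {..<x} then k y else y)"
  have "l \<in> homeo_on {..<x}"
    unfolding l_def using k(2) homeo_on_UNIV[OF k(1)] by (intro restrict_homeo_on) (auto intro!: exI[of _ x])
  then have l: "l \<in> homeo_on {a<..<b}"
    using homeo_on_fix[OF k(1)] x by (auto simp: homeo_on_def l_def)
  then have lH: "l \<in> H" using ab by blast
  have m: "finv l \<circ> k \<in> homeo_on {a<..<d}"
    using sub l by (intro comp_homeo_on inv_homeo_on k) auto
  moreover have "(finv l \<circ> k) y = y" if "y \<le> c" for y
    using that x by (simp add: inv_homeo_on_eq_iff[OF l]) (simp add: l_def)
  ultimately have "finv l \<circ> k \<in> homeo_on {c<..<d}"
    using homeo_on_fix[OF m] by (simp add: homeo_on_def not_less)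
  then have "k \<in> H" using H_factor[OF homeo_on_UNIV[OF k(1)] lH] cd by blast
  then have "finv g \<circ> k \<in> H" using g(1) by (simp add: H_comp H_inv)
  moreover have "finv g \<circ> k = f" by (auto simp: k_def homeo_on_inv_f[OF g(2)])
  ultimately show "f \<in> H" by simp
qed

lemma bounded_interval_in_H: "homeo_on {a<..<b} \<subseteq> H"
proof (cases "a \<le> b")
  case True
  \<comment> \<open>The margin makes the property additive: intervals sharing an endpoint overlap
    once enlarged.\<close>
  then have "\<exists>\<epsilon>>0. homeo_on {a - \<epsilon><..<b + \<epsilon>} \<subseteq> H"
  proof (induction rule: Bolzano)
    case (trans a b c)
    then obtain \<epsilon> \<delta> where e: "\<epsilon> > 0" "homeo_on {a - \<epsilon><..<b + \<epsilon>} \<subseteq> H" "\<delta> > 0" "homeo_on {b - \<delta><..<c + \<delta>} \<subseteq> H"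
      by blast
    define \<eta> where "\<eta> = min \<epsilon> \<delta>"
    have "homeo_on {a - \<eta><..<b + \<eta>} \<subseteq> homeo_on {a - \<epsilon><..<b + \<epsilon>}"
      "homeo_on {b - \<eta><..<c + \<eta>} \<subseteq> homeo_on {b - \<delta><..<c + \<delta>}"
      by (rule homeo_on_mono; auto simp: \<eta>_def)+
    then have "homeo_on {a - \<eta><..<c + \<eta>} \<subseteq> H"
      using e trans by (intro overlapping_intervals_in_H[of "a - \<eta>" "b + \<eta>" "b - \<eta>" "c + \<eta>"]) (auto simp: \<eta>_def)
    moreover have "\<eta> > 0" using e by (simp add: \<eta>_def)
    ultimately show ?case by blast
  next
    case (local x)
    obtain a b where ab: "a < x" "x < b" "homeo_on {a<..<b} \<subseteq> H"
      using bad_points_empty unfolding bad_points_def by blast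
    \<comment> \<open>An interval around \<open>x\<close> of length below \<open>d\<close>, enlarged
      by \<open>d\<close>, stays within \<open>2 * d\<close> of \<open>x\<close>.\<close>
    define d where "d = min (x - a) (b - x) / 2"
    have d: "d > 0" "2 * d \<le> x - a" "2 * d \<le> b - x" using ab by (auto simp: d_def)
    have "\<exists>\<epsilon>>0. homeo_on {s - \<epsilon><..<t + \<epsilon>} \<subseteq> H" if "s \<le> x \<and> x \<le> t \<and> t - s < d" for s t
    proof -
      have "homeo_on {s - d<..<t + d} \<subseteq> homeo_on {a<..<b}"
        using that d by (intro homeo_on_mono) auto
      then show ?thesis using ab d by blast
    qed
    then show ?case using d by blast
  qed
  then obtain \<epsilon> where "\<epsilon> > 0" "homeo_on {a - \<epsilon><..<b + \<epsilon>} \<subseteq> H" by blast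
  moreover have "{a<..<b} \<subseteq> {a - \<epsilon><..<b + \<epsilon>}" using \<open>\<epsilon> > 0\<close> by auto
  ultimately show ?thesis using homeo_on_mono by blast
next
  case False
  then have "{a<..<b} = {}" by auto
  then have "f = id" if "f \<in> homeo_on {a<..<b}" for f using homeo_on_fix[OF that] by auto
  then show ?thesis using H_id by blast
qed

text \<open>Only finitely many integers have small absolute value, so what the tail misses has
  bounded support.\<close>

lemma separated_union_in_H:
  fixes v p q w :: "int \<Rightarrow> real"
  assumes vpqw: "\<And>k. v k < p k" "\<And>k. p k < q k" "\<And>k. q k < w k"
    and d: "disjoint_family (\<lambda>k. {v k<..<w k})"
  shows "homeo_on (\<Union>k. {p k<..<q k}) \<subseteq> H"
proof
  fix f assume f: "f \<in> homeo_on (\<Union>k. {p k<..<q k})"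
  obtain N where N: "homeo_on (\<Union>k\<in>{k. N \<le> nat \<bar>k\<bar>}. {p k<..<q k}) \<subseteq> H"
    using tail_in_H[OF vpqw d, where \<iota> = "\<lambda>k. nat \<bar>k\<bar>"] by blast
  define A where "A = (\<Union>k\<in>{k. N \<le> nat \<bar>k\<bar>}. {p k<..<q k})"
  \<comment> \<open>Fixed endpoints allow the part of \<open>f\<close> on the tail to be cut out as
    a homeomorphism.\<close>
  have fixed: "f (p k) = p k \<and> f (q k) = q k" for k
  proof -
    have "p k \<notin> {p j<..<q j} \<and> q k \<notin> {p j<..<q j}" for j
      using disjoint_family_onD[OF d, of k j] vpqw[of k] vpqw[of j] by (cases "j = k") fastforce+
    then show ?thesis using homeo_on_fix[OF f] by blast
  qed
  define t where "t = (\<lambda>x. if x \<in> A then f x else x)"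
  have t: "t \<in> homeo_on A"
    unfolding t_def
  proof (rule restrict_homeo_on[OF homeo_on_UNIV[OF f]])
    fix x y assume "x \<in> A" "y \<notin> A"
    then obtain k where "x \<in> {p k<..<q k}" "y \<notin> {p k<..<q k}" by (auto simp: A_def)
    then have "x \<le> p k \<and> p k \<le> y \<or> y \<le> p k \<and> p k \<le> x \<or> x \<le> q k \<and> q k \<le> y \<or> y \<le> q k \<and> q k \<le> x" by auto
    then show "\<exists>z. f z = z \<and> (x \<le> z \<and> z \<le> y \<or> y \<le> z \<and> z \<le> x)" using fixed by blast
  qed
  have tH: "t \<in> H" using t N by (auto simp: A_def)
  have "bounded (\<Union>k\<in>{k. nat \<bar>k\<bar> < N}. {p k<..<q k})"
  proof (rule bounded_UN)
    have "{k. nat \<bar>k\<bar> < N} \<subseteq> {- int N..int N}" by auto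
    then show "finite {k. nat \<bar>k\<bar> < N}" by (rule finite_subset) simp
  qed simp
  then obtain M where M: "(\<Union>k\<in>{k. nat \<bar>k\<bar> < N}. {p k<..<q k}) \<subseteq> {-M<..<M}"
    by (auto simp: bounded_pos_less abs_less_iff subset_eq) (metis minus_less_iff)
  have "(finv t \<circ> f) x = x" if x: "x \<notin> {-M<..<M}" for x
  proof (cases "x \<in> A")
    case True
    then show ?thesis by (simp add: inv_homeo_on_eq_iff[OF t]) (simp add: t_def)
  next
    case False
    then have "x \<notin> (\<Union>k. {p k<..<q k})"
      using x M unfolding A_def by (force simp: not_le)
    then have "f x = x" using homeo_on_fix[OF f] by blast
    then show ?thesis using False by (simp add: inv_homeo_on_eq_iff[OF t]) (simp add: t_def)
  qed
  moreover have "finv t \<circ> f \<in> homeo_on UNIV"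
    using f t by (intro comp_homeo_on inv_homeo_on) (auto intro: homeo_on_UNIV)
  ultimately have "finv t \<circ> f \<in> homeo_on {-M<..<M}" by (simp add: homeo_on_def)
  then show "f \<in> H" using H_factor[OF homeo_on_UNIV[OF f] tH] bounded_interval_in_H by blast
qed


theorem all_in_H: "homeo_on UNIV \<subseteq> H"
proof
  fix f :: "real \<Rightarrow> real" assume f: "f \<in> homeo_on UNIV"
  \<comment> \<open>The block from \<open>l x\<close> to \<open>u x\<close> contains both
    \<open>x\<close> and \<open>f x\<close>.\<close>
  define u where "u x = max (f x) (id x)" for x
  define l where "l x = min (f x) (id x)" for x
  have u: "u \<in> homeo_on UNIV" and l: "l \<in> homeo_on UNIV"
    unfolding u_def[abs_def] l_def[abs_def]
    by (rule max_homeo_on[OF f id_homeo_on], rule min_homeo_on[OF f id_homeo_on])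
  have lu: "l x \<le> x" "x \<le> u x" "l x \<le> f x" "f x \<le> u x" for x by (auto simp: l_def u_def)
  have l_mono: "l x \<le> l y" if "x \<le> y" for x y using homeo_on_le[OF l] that by simp
  have "(\<lambda>x. x + 1 :: real) \<in> homeo_on UNIV"
    by (rule homeo_onI) (auto intro: exI[of _ "_ - 1"])
  \<comment> \<open>Chosen so that \<open>y (k + 1) = ?R (y k)\<close> means
    \<open>l (y (k + 1)) = u (y k) + 1\<close>: consecutive blocks are at distance 1.\<close>
  then have R: "finv l \<circ> (\<lambda>x. x + 1) \<circ> u \<in> homeo_on UNIV" (is "?R \<in> _")
    by (intro comp_homeo_on inv_homeo_on u l)
  define y :: "int \<Rightarrow> real" where "y k = (if 0 \<le> k then (?R ^^ nat k) 0 else (finv ?R ^^ nat (- k)) 0)" for k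
  have yR: "y (k + 1) = ?R (y k)" for k
  proof (cases "0 \<le> k")
    case True
    then show ?thesis by (simp add: y_def nat_add_distrib)
  next
    case False
    then have "nat (- k) = Suc (nat (- (k + 1)))" by simp
    then have "y k = finv ?R (y (k + 1))" using False by (auto simp: y_def)
    then show ?thesis by (metis homeo_on_f_inv[OF R])
  qed
  have y_step: "u (y k) + 1 = l (y (k + 1))" for k
    unfolding yR by (simp add: homeo_on_f_inv[OF l])
  have y1: "y k + 1 \<le> y (k + 1)" for k
    using y_step[of k] lu[of "y k"] lu[of "y (k + 1)"] by linarith
  have yn: "y k + real n \<le> y (k + int n)" for k n
  proof (induction n)
    case (Suc n)
    then show ?case using y1[of "k + int n"] by (simp add: algebra_simps)
  qed simp
  have y_mono: "y i \<le> y j" if "i \<le> j" for i j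
    using yn[of i "nat (j - i)"] that by simp
  have ulsep: "u (y i) + 1 \<le> l (y j)" if "i < j" for i j
    using y_step[of i] l_mono[OF y_mono[of "i + 1" j]] that by simp

  \<comment> \<open>\<open>h \<in> H\<close> agrees with \<open>f\<close> at all \<open>y k\<close>, which leaves a map fixing every \<open>y k\<close>; that one splits
    into its restrictions to the even and the odd gaps, which are separated.\<close>
  have "\<exists>a\<in>homeo_on {l (y k) - 1/4<..<u (y k) + 1/4}. a (y k) = f (y k)" for k
    using lu[of "y k"] by (intro homeo_on_push) auto
  then obtain a where a: "\<And>k. a k \<in> homeo_on {l (y k) - 1/4<..<u (y k) + 1/4}" "\<And>k. a k (y k) = f (y k)"
    by metis
  have da: "disjoint_family (\<lambda>k. {l (y k) - 1/4<..<u (y k) + 1/4})"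
  proof (intro disjoint_family_intervals disjI1)
    show "u (y i) + 1/4 \<le> l (y j) - 1/4" if "i < j" for i j using ulsep[OF that] by simp
  qed
  define h where "h = glue (\<lambda>k. {l (y k) - 1/4<..<u (y k) + 1/4}) a"
  have h: "h \<in> homeo_on (\<Union>k. {l (y k) - 1/4<..<u (y k) + 1/4})"
    unfolding h_def by (rule glue_homeo_on[OF da a(1)])
  have "h (y k) = f (y k)" for k
    unfolding h_def using lu[of "y k"] by (subst glue_eq[OF da, of _ k]) (auto simp: a(2))
  then have fixed: "(finv h \<circ> f) (y k) = y k" for k by (simp add: inv_homeo_on_eq_iff[OF h])
  \<comment> \<open>Blocks at distance at least 1 stay disjoint when widened by 1/2; the smaller
    margin 1/4 of the supports leaves the room that separation demands.\<close>
  have "homeo_on (\<Union>k. {l (y k) - 1/4<..<u (y k) + 1/4}) \<subseteq> H"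
  proof (rule separated_union_in_H)
    show "l (y k) - 1/2 < l (y k) - 1/4" "u (y k) + 1/4 < u (y k) + 1/2"
      "l (y k) - 1/4 < u (y k) + 1/4" for k using lu[of "y k"] by auto
    show "disjoint_family (\<lambda>k. {l (y k) - 1/2<..<u (y k) + 1/2})"
    proof (intro disjoint_family_intervals disjI1)
      show "u (y i) + 1/2 \<le> l (y j) - 1/2" if "i < j" for i j using ulsep[OF that] by simp
    qed
  qed
  then have hH: "h \<in> H" using h by blast

  define k where "k = finv h \<circ> f"
  have k: "k \<in> homeo_on UNIV" "\<And>i. k (y i) = y i"
    unfolding k_def using comp_homeo_on[OF inv_homeo_on[OF homeo_on_UNIV[OF h]] f] fixed by auto
  \<comment> \<open>Between two gaps of the same parity lies a gap of length at least 1, so widening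
    by 1/2 keeps them disjoint.\<close>
  have alternate: "homeo_on (\<Union>i. {y (2 * i + m)<..<y (2 * i + m + 1)}) \<subseteq> H" for m
  proof (rule separated_union_in_H)
    show "y (2 * i + m) - 1/2 < y (2 * i + m)" "y (2 * i + m + 1) < y (2 * i + m + 1) + 1/2"
      "y (2 * i + m) < y (2 * i + m + 1)" for i using y1[of "2 * i + m"] by auto
    show "disjoint_family (\<lambda>i. {y (2 * i + m) - 1/2<..<y (2 * i + m + 1) + 1/2})"
    proof (intro disjoint_family_intervals disjI1)
      show "y (2 * i + m + 1) + 1/2 \<le> y (2 * j + m) - 1/2" if "i < j" for i j
        using y1[of "2 * i + m + 1"] y_mono[of "2 * i + m + 1 + 1" "2 * j + m"] that by simp
    qed
  qed
  define E where "E = (\<Union>i. {y (2 * i + 0)<..<y (2 * i + 0 + 1)})"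
  define e where "e = (\<lambda>x. if x \<in> E then k x else x)"
  have e: "e \<in> homeo_on E"
    unfolding e_def
  proof (rule restrict_homeo_on[OF k(1)])
    fix x z assume "x \<in> E" "z \<notin> E"
    then obtain i where i: "x \<in> {y i<..<y (i + 1)}" "z \<notin> {y i<..<y (i + 1)}" by (auto simp: E_def)
    then show "\<exists>z'. k z' = z' \<and> (x \<le> z' \<and> z' \<le> z \<or> z \<le> z' \<and> z' \<le> x)"
      using k(2)[of i] k(2)[of "i + 1"] by (cases "z \<le> y i") (auto intro: exI[of _ "y i"] exI[of _ "y (i + 1)"])
  qed
  have eH: "e \<in> H" using e alternate[of 0] unfolding E_def by blast
  have odd: "finv e \<circ> k \<in> homeo_on (\<Union>i. {y (2 * i + 1)<..<y (2 * i + 1 + 1)})"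
  proof -
    have "(finv e \<circ> k) x = x" if x: "x \<notin> (\<Union>i. {y (2 * i + 1)<..<y (2 * i + 1 + 1)})" for x
    proof (cases "x \<in> E")
      case True
      then show ?thesis by (simp add: inv_homeo_on_eq_iff[OF e]) (simp add: e_def)
    next
      case False
      \<comment> \<open>The \<open>y i\<close> are unbounded in both directions, so \<open>x\<close>
        lies in some half-open gap; being in no even or odd open gap, it is the left
        endpoint.\<close>
      obtain n where "\<bar>x\<bar> + \<bar>y 0\<bar> \<le> real n" using real_arch_simple by blast
      then have n: "y (- int n) \<le> x" "x \<le> y (int n)" using yn[of "- int n" n] yn[of 0 n] by auto
      have "\<exists>i. y i \<le> x \<and> x < y (i + 1)"
      proof (rule ccontr)
        assume no: "\<nexists>i. y i \<le> x \<and> x < y (i + 1)"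
        have "y (- int n + int m) \<le> x" for m
        proof (induction m)
          case (Suc m)
          then show ?case using no by (metis add.assoc int_Suc not_le_imp_less add.commute)
        qed (use n in simp)
        from this[of "n + n + 1"] show False using n yn[of "int n" 1] by simp
      qed
      then obtain i where i: "y i \<le> x" "x < y (i + 1)" by blast
      have "x = y i"
      proof (rule ccontr)
        assume "x \<noteq> y i"
        then have xi: "x \<in> {y i<..<y (i + 1)}" using i by auto
        show False
        proof (cases "even i")
          case True
          then obtain j where "i = 2 * j + 0" by (auto elim: evenE)
          then show False using xi False unfolding E_def by blast
        next
          case False
          then obtain j where "i = 2 * j + 1" by (auto elim: oddE)
          then show False using xi x by blast
        qed
      qed
      then have "k x = x" using k(2) by simp
      then show ?thesis using False by (simp add: inv_homeo_on_eq_iff[OF e]) (simp add: e_def)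
    qed
    moreover have "finv e \<circ> k \<in> homeo_on UNIV"
      using e k(1) by (intro comp_homeo_on inv_homeo_on) (auto intro: homeo_on_UNIV)
    ultimately show ?thesis by (simp add: homeo_on_def)
  qed
  then have "k \<in> H" using H_factor[OF k(1) eH] alternate[of 1] by blast
  then show "f \<in> H" using H_factor[OF f hH] by (simp add: k_def)
qed

end

section \<open>Transfer to abstract groups; the line\<close>

lemma (in group) small_index_collision:
  assumes H: "subgroup H G" "rcosets H \<prec> (UNIV :: nat set set)"
    and g: "\<And>S :: nat set. g S \<in> carrier G"
  shows "\<exists>S T. S \<noteq> T \<and> g S \<otimes> inv (g T) \<in> H"
proof -
  have "\<not> inj (\<lambda>S. H #> g S)"
  proof
    assume "inj (\<lambda>S. H #> g S)"
    then have "(UNIV :: nat set set) \<lesssim> rcosets H"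
      using g by (auto simp: lepoll_def RCOSETS_def)
    then show False using H(2) lepoll_antisym unfolding lesspoll_def by blast
  qed
  then obtain S T where ST: "S \<noteq> T" "H #> g S = H #> g T" by (auto simp: inj_def)
  then have "g S \<in> H #> g T" using rcos_self[OF g H(1), of S] by simp
  then show ?thesis using subgroup.rcos_module_imp[OF H(1) is_group g] ST(1) by blast
qed

text \<open>The preimage of \<open>H\<close> under \<open>\<Phi>\<close> inherits the coset
  collisions and so satisfies \<open>small_index_subgroup\<close>. For the line
  \<open>\<Phi>\<close> is the inclusion, for the circle the action on an arc.\<close>

lemma (in group) homeo_on_image_in_small_index_subgroup:
  assumes H: "subgroup H G" "rcosets H \<prec> (UNIV :: nat set set)"
    and \<Phi>: "\<And>f. f \<in> homeo_on UNIV \<Longrightarrow> \<Phi> f \<in> carrier G"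
    and mult: "\<And>f g. f \<in> homeo_on UNIV \<Longrightarrow> g \<in> homeo_on UNIV \<Longrightarrow> \<Phi> (f \<circ> g) = \<Phi> f \<otimes> \<Phi> g"
    and f: "f \<in> homeo_on UNIV"
  shows "\<Phi> f \<in> H"
proof -
  have "\<Phi> id \<otimes> \<Phi> id = \<Phi> id" using mult[OF id_homeo_on id_homeo_on] by simp
  then have id: "\<Phi> id = \<one>" using \<Phi>[OF id_homeo_on] by simp
  have inv: "\<Phi> (finv g) = inv (\<Phi> g)" if g: "g \<in> homeo_on UNIV" for g
  proof -
    have "finv g \<circ> g = id" by (auto simp: homeo_on_inv_f[OF g])
    then have "\<Phi> (finv g) \<otimes> \<Phi> g = \<one>" using mult[OF inv_homeo_on[OF g] g] id by simp
    then show ?thesis using \<Phi> g inv_homeo_on[OF g] by (simp add: inv_equality)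
  qed
  interpret small_index_subgroup "{f \<in> homeo_on UNIV. \<Phi> f \<in> H}"
  proof
    show "f \<circ> h \<in> {f \<in> homeo_on UNIV. \<Phi> f \<in> H}"
      if "f \<in> {f \<in> homeo_on UNIV. \<Phi> f \<in> H}" "h \<in> {f \<in> homeo_on UNIV. \<Phi> f \<in> H}" for f h
      using that comp_homeo_on[of f UNIV h] mult[of f h] subgroup.m_closed[OF H(1), of "\<Phi> f" "\<Phi> h"] by simp
    show "finv h \<in> {f \<in> homeo_on UNIV. \<Phi> f \<in> H}"
      if "h \<in> {f \<in> homeo_on UNIV. \<Phi> f \<in> H}" for h
      using that inv_homeo_on[of h UNIV] inv[of h] subgroup.m_inv_closed[OF H(1), of "\<Phi> h"] by simp
  next
    fix g :: "nat set \<Rightarrow> real \<Rightarrow> real" assume g: "\<And>S. g S \<in> homeo_on UNIV"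
    have "\<exists>S T. S \<noteq> T \<and> \<Phi> (g S) \<otimes> inv (\<Phi> (g T)) \<in> H"
      by (rule small_index_collision[OF H]) (rule \<Phi>[OF g])
    then obtain S T where "S \<noteq> T" "\<Phi> (g S) \<otimes> inv (\<Phi> (g T)) \<in> H" by blast
    then show "\<exists>S T. S \<noteq> T \<and> g S \<circ> finv (g T) \<in> {f \<in> homeo_on UNIV. \<Phi> f \<in> H}"
      using comp_homeo_on[OF g inv_homeo_on[OF g], of S T] mult[OF g inv_homeo_on[OF g], of S T] inv[OF g, of T]
      by (intro exI[of _ S] exI[of _ T]) simp
  qed simp
  show ?thesis using subsetD[OF all_in_H f] by simp
qed

text \<open>\<open>r\<close> will be a reflection. A subgroup above \<open>P\<close> with some
  \<open>x\<close> outside \<open>P\<close> contains \<open>x \<otimes> r\<close>, hence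
  \<open>r\<close>, hence everything.\<close>

lemma (in group) unique_small_index_subgroup:
  assumes P: "subgroup P G" and r: "r \<in> carrier G" "r \<notin> P"
    and two: "\<And>x. x \<in> carrier G \<Longrightarrow> x \<in> P \<or> x \<otimes> r \<in> P"
    and least: "\<And>H. subgroup H G \<Longrightarrow> rcosets H \<prec> (UNIV :: nat set set) \<Longrightarrow> P \<subseteq> H"
  shows "{H. subgroup H G \<and> H \<noteq> carrier G \<and> rcosets H \<prec> (UNIV :: nat set set)} = {P}"
proof -
  have "P #> x \<in> {P, P #> inv r}" if x: "x \<in> carrier G" for x
  proof (cases "x \<in> P")
    case True
    then show ?thesis using coset_join2[OF x P] by simp
  next
    case False
    then have xr: "x \<otimes> r \<in> P" using two x by blast
    have "x = (x \<otimes> r) \<otimes> inv r" using x r by (simp add: m_assoc)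
    then have "x \<in> P #> inv r" using xr by (auto simp: r_coset_def)
    then have "P #> inv r = P #> x" using repr_independence P r by simp
    then show ?thesis by simp
  qed
  then have "rcosets P \<subseteq> {P, P #> inv r}" by (auto simp: RCOSETS_def)
  then have "finite (rcosets P)" by (rule finite_subset) simp
  moreover have "infinite (UNIV :: nat set set)" by (simp add: Finite_Set.finite_set)
  ultimately have small: "rcosets P \<prec> (UNIV :: nat set set)" by (intro finite_lesspoll_infinite)
  have "H = P" if H: "subgroup H G" "H \<noteq> carrier G" "rcosets H \<prec> (UNIV :: nat set set)" for H
  proof (rule ccontr)
    assume "H \<noteq> P"
    then obtain x where x: "x \<in> H" "x \<notin> P" using least[OF H(1,3)] by blast
    have PH: "P \<subseteq> H" using least H by blast
    have xG: "x \<in> carrier G" using subgroup.mem_carrier[OF H(1) x(1)] .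
    then have xr: "x \<otimes> r \<in> H" using two[OF xG] x PH by auto
    have "r = inv x \<otimes> (x \<otimes> r)" using xG r by (simp add: m_assoc[symmetric])
    then have rH: "r \<in> H"
      using subgroup.m_closed[OF H(1) subgroup.m_inv_closed[OF H(1) x(1)] xr] by simp
    have "y \<in> H" if y: "y \<in> carrier G" for y
    proof (cases "y \<in> P")
      case False
      then have yr: "y \<otimes> r \<in> H" using two[OF y] PH by auto
      moreover have "y = (y \<otimes> r) \<otimes> inv r" using y r by (simp add: m_assoc)
      ultimately show ?thesis
        using subgroup.m_closed[OF H(1) yr subgroup.m_inv_closed[OF H(1) rH]] by simp
    qed (use PH in blast)
    then show False using H(2) subgroup.subset[OF H(1)] by blast
  qed
  then show ?thesis using small P r by blast
qed

lemma mult_Homeo_group: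
  "f \<in> Homeo X \<Longrightarrow> g \<in> Homeo X \<Longrightarrow> f \<otimes>\<^bsub>Homeo_group X\<^esub> g = compose (topspace X) f g"
  using Homeo_subset_Bij[of X] by (auto simp: Homeo_group_def BijGroup_def)

lemma carrier_Homeo_group: "carrier (Homeo_group X) = Homeo X"
  by (simp add: Homeo_group_def)

lemma continuous_homeo_on: "f \<in> homeo_on U \<Longrightarrow> continuous_on S f"
proof -
  assume f: "f \<in> homeo_on U"
  have "surj f" using f by (simp add: homeo_on_def)
  then have "continuous_on UNIV f" using homeo_on_le[OF f] by (intro continuous_onI_mono) auto
  then show ?thesis using continuous_on_subset by blast
qed

lemma Homeo_plus_real_eq: "Homeo_plus_real = homeo_on UNIV"
proof (intro Set.set_eqI iffI)
  fix f assume "f \<in> Homeo_plus_real"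
  then show "f \<in> homeo_on UNIV"
    using homeomorphic_imp_surjective_map[of euclideanreal euclideanreal f]
    by (auto simp: Homeo_plus_real_def Homeo_def homeo_on_def)
next
  fix f :: "real \<Rightarrow> real" assume f: "f \<in> homeo_on UNIV"
  then have "homeomorphic_maps euclideanreal euclideanreal f (finv f)"
    by (auto simp: homeomorphic_maps_def continuous_homeo_on[OF f] continuous_homeo_on[OF inv_homeo_on[OF f]]
        homeo_on_inv_f[OF f] homeo_on_f_inv[OF f])
  then show "f \<in> Homeo_plus_real"
    using f by (auto simp: Homeo_plus_real_def Homeo_def homeomorphic_map_maps homeo_on_def)
qed

text \<open>A continuous injection of the line is strictly monotone.\<close>

lemma homeo_real_cases:
  assumes f: "f \<in> Homeo euclideanreal"
  shows "f \<in> Homeo_plus_real \<or> f \<circ> uminus \<in> Homeo_plus_real"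
proof -
  have hom: "homeomorphic_map euclideanreal euclideanreal f" using f by (simp add: Homeo_def)
  have "continuous_on UNIV f" "inj f" "surj f"
    using homeomorphic_imp_continuous_map[OF hom] homeomorphic_imp_injective_map[OF hom]
      homeomorphic_imp_surjective_map[OF hom] by auto
  then have "strict_mono f \<or> strict_antimono_on UNIV f"
    using injective_eq_monotone_map[of UNIV f] by (simp add: is_interval_univ)
  then have "f \<in> homeo_on UNIV \<or> f \<circ> uminus \<in> homeo_on UNIV"
  proof
    assume "strict_antimono_on UNIV f"
    then have "strict_mono (f \<circ> uminus)" by (auto simp: monotone_on_def)
    moreover have "surj (f \<circ> uminus)" using \<open>surj f\<close> by (intro comp_surj surj_uminus)
    ultimately show ?thesis by (simp add: homeo_on_def)
  qed (use \<open>surj f\<close> in \<open>simp add: homeo_on_def\<close>)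
  then show ?thesis by (simp add: Homeo_plus_real_eq)
qed

theorem small_index_subgroups_real:
  "{H. subgroup H (Homeo_group euclideanreal) \<and> H \<noteq> carrier (Homeo_group euclideanreal) \<and>
      (rcosets\<^bsub>Homeo_group euclideanreal\<^esub> H) \<prec> (UNIV :: nat set set)} = {Homeo_plus_real}"
proof -
  interpret group "Homeo_group euclideanreal" by (rule group_Homeo_group)
  have sub: "homeo_on UNIV \<subseteq> Homeo euclideanreal"
    using Homeo_plus_real_eq by (auto simp: Homeo_plus_real_def)
  have mult: "f \<otimes>\<^bsub>Homeo_group euclideanreal\<^esub> g = f \<circ> g" if "f \<in> Homeo euclideanreal" "g \<in> Homeo euclideanreal" for f g
    using mult_Homeo_group[OF that] by (auto simp: compose_def)
  have "homeomorphic_maps euclideanreal euclideanreal uminus uminus"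
    by (auto simp: homeomorphic_maps_def intro: continuous_intros)
  then have neg: "uminus \<in> Homeo euclideanreal" by (auto simp: Homeo_def homeomorphic_map_maps)
  have inv: "inv\<^bsub>Homeo_group euclideanreal\<^esub> f = finv f" if f: "f \<in> homeo_on UNIV" for f
  proof (rule inv_equality)
    have "homeomorphic_map euclideanreal euclideanreal id" by simp
    then have "id \<in> Homeo euclideanreal" by (simp add: Homeo_def)
    have "finv f \<circ> f = id" by (auto simp: homeo_on_inv_f[OF f])
    then show "finv f \<otimes>\<^bsub>Homeo_group euclideanreal\<^esub> f = \<one>\<^bsub>Homeo_group euclideanreal\<^esub>"
      using f inv_homeo_on[OF f] sub by (auto simp: mult subset_iff) (auto simp: Homeo_group_def BijGroup_def)
  qed (use f inv_homeo_on[OF f] sub in \<open>auto simp: carrier_Homeo_group\<close>)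
  show ?thesis
  proof (rule unique_small_index_subgroup)
    show "subgroup Homeo_plus_real (Homeo_group euclideanreal)"
      unfolding Homeo_plus_real_eq
    proof (rule subgroupI)
      show "homeo_on UNIV \<noteq> {}" using id_homeo_on by blast
      show "a \<otimes>\<^bsub>Homeo_group euclideanreal\<^esub> b \<in> homeo_on UNIV" if "a \<in> homeo_on UNIV" "b \<in> homeo_on UNIV" for a b
        using that sub comp_homeo_on[OF that] by (simp add: mult subset_iff)
    qed (use sub inv inv_homeo_on in \<open>auto simp: carrier_Homeo_group\<close>)
    show "uminus \<in> carrier (Homeo_group euclideanreal)" by (simp add: carrier_Homeo_group neg)
    show "uminus \<notin> Homeo_plus_real"
      using strict_mono_less[of "uminus :: real \<Rightarrow> real" 0 1] by (auto simp: Homeo_plus_real_def)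
    show "x \<in> Homeo_plus_real \<or> x \<otimes>\<^bsub>Homeo_group euclideanreal\<^esub> uminus \<in> Homeo_plus_real"
      if "x \<in> carrier (Homeo_group euclideanreal)" for x
      using that homeo_real_cases neg by (simp add: mult carrier_Homeo_group)
    show "Homeo_plus_real \<subseteq> H"
      if "subgroup H (Homeo_group euclideanreal)" "rcosets\<^bsub>Homeo_group euclideanreal\<^esub> H \<prec> (UNIV :: nat set set)" for H
      using homeo_on_image_in_small_index_subgroup[OF that, of "\<lambda>f. f"] sub
      by (auto simp: Homeo_plus_real_eq carrier_Homeo_group mult subset_iff)
  qed
qed

section \<open>The circle\<close>

lemma cis_eq_cis_iff: "cis s = cis t \<longleftrightarrow> (\<exists>n :: int. s = t + 2 * pi * n)"
  using sin_cos_eq_iff[of s t] by (auto simp: complex_eq_iff)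

lemma cis_Arg_sphere: "w \<in> sphere 0 1 \<Longrightarrow> cis (Arg w) = w"
  by (cases "w = 0") (auto simp: cis_Arg sgn_eq)

text \<open>These maps commute with the deck transformations of the universal covering; they are the
  lifts of the orientation preserving homeomorphisms of the circle.\<close>

definition periodic_homeos :: "(real \<Rightarrow> real) set" where
  "periodic_homeos = {F \<in> homeo_on UNIV. \<forall>t. F (t + 2 * pi) = F t + 2 * pi}"

lemma periodic_homeos_int:
  assumes F: "F \<in> periodic_homeos" shows "F (t + 2 * pi * real_of_int n) = F t + 2 * pi * n"
proof -
  have step: "F (t + 2 * pi) = F t + 2 * pi" for t using F by (simp add: periodic_homeos_def)
  have nat: "F (t + 2 * pi * real n) = F t + 2 * pi * n" for t n
  proof (induction n)
    case (Suc n)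
    then show ?case using step[of "t + 2 * pi * real n"] by (simp add: algebra_simps)
  qed simp
  show ?thesis
  proof (cases "0 \<le> n")
    case True
    then show ?thesis using nat[of t "nat n"] by simp
  next
    case False
    then show ?thesis using nat[of "t + 2 * pi * real_of_int n" "nat (- n)"] by simp
  qed
qed

lemma periodic_homeos_comp:
  "F \<in> periodic_homeos \<Longrightarrow> G \<in> periodic_homeos \<Longrightarrow> F \<circ> G \<in> periodic_homeos"
  by (simp add: periodic_homeos_def comp_homeo_on)

lemma periodic_homeos_inv:
  assumes F: "F \<in> periodic_homeos" shows "finv F \<in> periodic_homeos"
proof -
  have F': "F \<in> homeo_on UNIV" using F by (simp add: periodic_homeos_def)
  have "finv F (t + 2 * pi) = finv F t + 2 * pi" for t
    using F by (simp add: inv_homeo_on_eq_iff[OF F']) (simp add: periodic_homeos_def homeo_on_f_inv[OF F'])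
  then show ?thesis using inv_homeo_on[OF F'] by (simp add: periodic_homeos_def)
qed

text \<open>For periodic \<open>F\<close> the choice of a branch of the argument does not affect the
  value.\<close>

definition circle_map :: "(real \<Rightarrow> real) \<Rightarrow> complex \<Rightarrow> complex" where
  "circle_map F = restrict (\<lambda>w. cis (F (Arg w))) (sphere 0 1)"

lemma circle_map_cis:
  assumes F: "F \<in> periodic_homeos" shows "circle_map F (cis t) = cis (F t)"
proof -
  have "cis (Arg (cis t)) = cis t" by (simp add: cis_Arg_sphere)
  then obtain n :: int where "Arg (cis t) = t + 2 * pi * n" using cis_eq_cis_iff by blast
  then have "F (Arg (cis t)) = F t + 2 * pi * n" using periodic_homeos_int[OF F] by simp
  then have "cis (F (Arg (cis t))) = cis (F t)" using cis_eq_cis_iff by blast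
  then show ?thesis by (simp add: circle_map_def)
qed

lemma eq_on_circle:
  assumes "f \<in> extensional (sphere 0 1)" "g \<in> extensional (sphere 0 1)" "\<And>t. f (cis t) = g (cis t)"
  shows "f = g"
proof (rule extensionalityI[OF assms(1,2)])
  fix w :: complex assume "w \<in> sphere 0 1"
  then show "f w = g w" using assms(3)[of "Arg w"] by (simp only: cis_Arg_sphere)
qed

lemma circle_map_comp:
  assumes F: "F \<in> periodic_homeos" and G: "G \<in> periodic_homeos"
  shows "circle_map (F \<circ> G) = compose (sphere 0 1) (circle_map F) (circle_map G)"
proof (rule eq_on_circle)
  show "circle_map (F \<circ> G) (cis t) = compose (sphere 0 1) (circle_map F) (circle_map G) (cis t)" for t
    by (simp add: circle_map_cis F G periodic_homeos_comp compose_eq)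
qed (auto simp: circle_map_def)

lemma circle_map_id: "circle_map id = restrict id (sphere 0 1)"
  by (auto simp: circle_map_def restrict_def cis_Arg_sphere fun_eq_iff)

text \<open>\<open>Arg\<close> jumps at -1, so continuity is tested after composition with
  \<open>cis\<close>, a quotient map because it takes a compact interval onto a Hausdorff
  space.\<close>

lemma continuous_map_circle_map:
  assumes F: "F \<in> periodic_homeos" shows "continuous_map circle circle (circle_map F)"
proof -
  have "cis ` {0..2 * pi} = sphere 0 1"
  proof (intro equalityI subsetI)
    fix w :: complex assume w: "w \<in> sphere 0 1"
    obtain t where "0 \<le> t" "t < 2 * pi" "w = cis t"
    proof (cases "0 \<le> Arg w")
      case True
      then show thesis using that[of "Arg w"] w cis_Arg_sphere[of w] Arg_bounded[of w] by auto
    next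
      case False
      moreover have "cis (Arg w + 2 * pi) = cis (Arg w)" by (simp add: complex_eq_iff)
      ultimately show thesis
        using that[of "Arg w + 2 * pi"] w cis_Arg_sphere[of w] Arg_bounded[of w] by auto
    qed
    then show "w \<in> cis ` {0..2 * pi}" by auto
  qed auto
  then have "quotient_map (top_of_set {0..2 * pi}) circle cis"
    by (intro T1_Spaces.continuous_imp_quotient_map)
      (auto simp: compact_space_subtopology Hausdorff_space_subtopology intro!: continuous_intros)
  moreover have "continuous_map (top_of_set {0..2 * pi}) circle (circle_map F \<circ> cis)"
  proof -
    have F': "F \<in> homeo_on UNIV" using F by (simp add: periodic_homeos_def)
    have "circle_map F \<circ> cis = (\<lambda>t. cis (F t))" using circle_map_cis[OF F] by auto
    then show ?thesis using continuous_homeo_on[OF F'] by (auto intro!: continuous_intros)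
  qed
  ultimately show ?thesis by (rule continuous_compose_quotient_map)
qed

lemma circle_map_Homeo:
  assumes F: "F \<in> periodic_homeos" shows "circle_map F \<in> Homeo circle"
proof -
  have F': "F \<in> homeo_on UNIV" using F by (simp add: periodic_homeos_def)
  note inv = periodic_homeos_inv[OF F]
  have "finv F \<circ> F = id" "F \<circ> finv F = id" by (auto simp: homeo_on_inv_f[OF F'] homeo_on_f_inv[OF F'])
  then have c: "compose (sphere 0 1) (circle_map (finv F)) (circle_map F) = restrict id (sphere 0 1)"
    "compose (sphere 0 1) (circle_map F) (circle_map (finv F)) = restrict id (sphere 0 1)"
    using circle_map_comp[OF inv F] circle_map_comp[OF F inv] circle_map_id by simp_all
  have cw: "circle_map (finv F) (circle_map F w) = w" "circle_map F (circle_map (finv F) w) = w"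
    if "w \<in> sphere 0 1" for w
    using fun_cong[OF c(1), of w] fun_cong[OF c(2), of w] that by (simp_all add: compose_def)
  have "homeomorphic_maps circle circle (circle_map F) (circle_map (finv F))"
    unfolding homeomorphic_maps_def 
    using cw continuous_map_circle_map[OF F] continuous_map_circle_map[OF inv] by simp
  then show ?thesis by (auto simp: Homeo_def homeomorphic_map_maps circle_map_def)
qed

section \<open>Circle homeomorphisms with a fixed point\<close>

text \<open>The coordinate \<open>x \<mapsto> \<theta> + pi + 2 * arctan x\<close> identifies the real line with the arc
  \<open>(\<theta>, \<theta> + 2 * pi)\<close>; its inverse, a tangent, is already periodic.\<close>

definition arc_lift :: "real \<Rightarrow> (real \<Rightarrow> real) \<Rightarrow> real \<Rightarrow> real" where
  "arc_lift \<theta> f t = (let u = (t - \<theta> - pi) / 2 in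
     if cos u = 0 then t else t + 2 * (arctan (f (tan u)) - arctan (tan u)))"

text \<open>The endpoints of the arcs are exactly the points caught by the cosine test in
  \<open>arc_lift\<close>.\<close>

lemma arc_lift_end: "arc_lift \<theta> f (\<theta> + 2 * pi * real_of_int m) = \<theta> + 2 * pi * m"
proof -
  have "cos ((\<theta> + 2 * pi * real_of_int m - \<theta> - pi) / 2) = cos (pi * m - pi / 2)"
    by (simp add: field_simps)
  also have "\<dots> = sin (pi * m)" by (simp add: cos_diff)
  finally show ?thesis by (simp add: arc_lift_def)
qed

text \<open>Adding only the increment of the arctangent keeps a point in its own arc, so the number
  \<open>m\<close> of the arc need not be computed.\<close>

lemma arc_lift_arc:
  "arc_lift \<theta> f (\<theta> + pi + 2 * pi * real_of_int m + 2 * arctan x) = \<theta> + pi + 2 * pi * m + 2 * arctan (f x)"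
proof -
  have u: "(\<theta> + pi + 2 * pi * real_of_int m + 2 * arctan x - \<theta> - pi) / 2 = arctan x + m * pi"
    by (simp add: field_simps)
  have "cos (arctan x + m * pi) = cos (arctan x) * cos (pi * m)"
    by (simp add: cos_add mult.commute)
  then have "cos (arctan x + m * pi) \<noteq> 0" by (auto simp: power_int_def)
  then show ?thesis
    unfolding arc_lift_def Let_def u by (simp add: tan_arctan)
qed

lemma arc_interior:
  assumes "\<theta> < t" "t < \<theta> + 2 * pi" shows "t = \<theta> + pi + 2 * arctan (tan ((t - \<theta> - pi) / 2))"
  using assms by (subst arctan_tan) (auto simp: field_simps)

lemma arc_cases [case_names endpoint arc]:
  fixes \<theta> t :: real
  obtains m :: int where "t = \<theta> + 2 * pi * m"
  | m :: int and x where "t = \<theta> + pi + 2 * pi * m + 2 * arctan x"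
proof -
  define m where "m = \<lfloor>(t - \<theta>) / (2 * pi)\<rfloor>"
  define s where "s = t - 2 * pi * m"
  have "of_int m \<le> (t - \<theta>) / (2 * pi)" "(t - \<theta>) / (2 * pi) < of_int m + 1"
    unfolding m_def by linarith+
  then have "\<theta> \<le> s" "s < \<theta> + 2 * pi" by (auto simp: s_def field_simps)
  then show thesis
    using that(1)[of m] that(2)[of m "tan ((s - \<theta> - pi) / 2)"] arc_interior[of \<theta> s]
    by (cases "s = \<theta>") (auto simp: s_def)
qed

lemma arc_lift_comp: "arc_lift \<theta> (f \<circ> g) = arc_lift \<theta> f \<circ> arc_lift \<theta> g"
proof
  show "arc_lift \<theta> (f \<circ> g) t = (arc_lift \<theta> f \<circ> arc_lift \<theta> g) t" for t
    by (cases t \<theta> rule: arc_cases) (simp_all add: arc_lift_end arc_lift_arc)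
qed

text \<open>The bounds of the arctangent confine each arc between its endpoints, so the order is
  decided by the arc number and, within one arc, by \<open>f\<close>.\<close>

lemma arc_lift_less:
  assumes f: "f \<in> homeo_on UNIV" and st: "s < t" shows "arc_lift \<theta> f s < arc_lift \<theta> f t"
proof -
  have le: "m \<le> n" if "2 * pi * real_of_int m < 2 * pi * n + 2 * pi" for m n :: int
  proof -
    have "2 * pi * real_of_int m < 2 * pi * real_of_int (n + 1)" using that by (simp add: algebra_simps)
    then show ?thesis by simp
  qed
  have step: "2 * pi * real_of_int m + 2 * pi \<le> 2 * pi * n" if "m < n" for m n :: int
  proof -
    have "2 * pi * real_of_int (m + 1) \<le> 2 * pi * real_of_int n" using that by (intro mult_left_mono) auto
    then show ?thesis by (simp add: algebra_simps)
  qed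
  have mono: "2 * pi * real_of_int m \<le> 2 * pi * n" if "m \<le> n" for m n :: int
    using that by simp
  note b = arctan_bounded
  show ?thesis
  proof (cases s \<theta> rule: arc_cases)
    case s: (endpoint m)
    show ?thesis
    proof (cases t \<theta> rule: arc_cases)
      case t: (endpoint n)
      then show ?thesis using s st by (simp add: arc_lift_end)
    next
      case t: (arc n y)
      have "m \<le> n" using st b[of y] unfolding s t by (intro le) linarith
      then show ?thesis 
        unfolding s t arc_lift_end arc_lift_arc using mono[of m n] b[of "f y"] by linarith
    qed
  next
    case s: (arc m x)
    show ?thesis
    proof (cases t \<theta> rule: arc_cases)
      case t: (endpoint n)
      have "m < n"
      proof (rule ccontr)
        assume "\<not> m < n"
        then show False using mono[of n m] st b[of x] unfolding s t by linarith
      qed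
      then show ?thesis 
        unfolding s t arc_lift_end arc_lift_arc using step[of m n] b[of "f x"] by linarith
    next
      case t: (arc n y)
      have "m \<le> n" using st b[of x] b[of y] unfolding s t by (intro le) linarith
      then consider "m < n" | "m = n" by linarith
      then show ?thesis
      proof cases
        case 1
        then show ?thesis 
          unfolding s t arc_lift_arc using step[of m n] b[of "f x"] b[of "f y"] by linarith
      next
        case 2
        then have "f x < f y" using st s t homeo_on_less[OF f] by (simp add: arctan_less_iff)
        then show ?thesis using 2 by (simp add: s t arc_lift_arc arctan_less_iff)
      qed
    qed
  qed
qed

lemma arc_lift_periodic_homeos:
  assumes f: "f \<in> homeo_on UNIV" shows "arc_lift \<theta> f \<in> periodic_homeos"
proof -
  have "arc_lift \<theta> id = id"
  proof
    show "arc_lift \<theta> id t = id t" for t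
      by (cases t \<theta> rule: arc_cases) (simp_all add: arc_lift_end arc_lift_arc)
  qed
  moreover have "f \<circ> finv f = id" by (auto simp: homeo_on_f_inv[OF f])
  ultimately have "arc_lift \<theta> f \<circ> arc_lift \<theta> (finv f) = id"
    using arc_lift_comp[of \<theta> f "finv f"] by simp
  then have "arc_lift \<theta> f (arc_lift \<theta> (finv f) t) = t" for t
    by (metis comp_apply id_apply)
  then have "arc_lift \<theta> f \<in> homeo_on UNIV"
    by (intro homeo_onI arc_lift_less f) auto
  moreover have "arc_lift \<theta> f (t + 2 * pi) = arc_lift \<theta> f t + 2 * pi" for t
  proof (cases t \<theta> rule: arc_cases)
    case (endpoint m)
    then show ?thesis using arc_lift_end[of \<theta> f m] arc_lift_end[of \<theta> f "m + 1"] by (simp add: algebra_simps)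
  next
    case (arc m x)
    then show ?thesis using arc_lift_arc[of \<theta> f m x] arc_lift_arc[of \<theta> f "m + 1" x] by (simp add: algebra_simps)
  qed
  ultimately show ?thesis by (simp add: periodic_homeos_def)
qed

text \<open>Fixing \<open>\<theta>\<close>, and by periodicity \<open>\<theta> + 2 * pi\<close>, the
  map \<open>F\<close> preserves the arc between them; \<open>f\<close> is \<open>F\<close> read in
  the coordinate of that arc.\<close>

lemma arc_lift_surj:
  assumes F: "F \<in> periodic_homeos" and F_fix: "F \<theta> = \<theta>"
  shows "\<exists>f\<in>homeo_on UNIV. arc_lift \<theta> f = F"
proof
  define c where "c x = \<theta> + pi + 2 * arctan x" for x
  define d where "d t = tan ((t - \<theta> - pi) / 2)" for t
  define f where "f x = d (F (c x))" for x
  have F': "F \<in> homeo_on UNIV" using F by (simp add: periodic_homeos_def)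
  have cd: "c (d t) = t" if "\<theta> < t" "t < \<theta> + 2 * pi" for t
    using arc_interior[OF that] by (simp add: c_def d_def)
  have dc: "d (c x) = x" for x by (simp add: c_def d_def tan_arctan)
  have c: "\<theta> < c x" "c x < \<theta> + 2 * pi" for x using arctan_bounded[of x] by (auto simp: c_def)
  have c_less: "c x < c y \<longleftrightarrow> x < y" for x y by (simp add: c_def arctan_less_iff)
  have F_ends: "F (\<theta> + 2 * pi * real_of_int m) = \<theta> + 2 * pi * m" for m
    using periodic_homeos_int[OF F, of \<theta> m] F_fix by simp
  have Fb: "\<theta> < F t \<longleftrightarrow> \<theta> < t" "F t < \<theta> + 2 * pi \<longleftrightarrow> t < \<theta> + 2 * pi" for t
    using homeo_on_less[OF F', of \<theta> t] homeo_on_less[OF F', of t "\<theta> + 2 * pi"] F_fix F_ends[of 1] by auto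
  have cf: "c (f x) = F (c x)" for x unfolding f_def using Fb c by (intro cd) auto
  show "f \<in> homeo_on UNIV"
  proof (rule homeo_onI)
    show "f x < f y" if "x < y" for x y
      using that homeo_on_less[OF F', of "c x" "c y"] c_less[of x y] c_less[of "f x" "f y"] cf by simp
    show "\<exists>x. f x = y" for y
    proof
      define t where "t = finv F (c y)"
      have Ft: "F t = c y" by (simp add: t_def homeo_on_f_inv[OF F'])
      then have "c (d t) = t" using Fb[of t] c[of y] by (intro cd) auto
      then show "f (d t) = y" by (simp add: f_def Ft dc)
    qed
  qed simp
  show "arc_lift \<theta> f = F"
  proof
    show "arc_lift \<theta> f t = F t" for t
    proof (cases t \<theta> rule: arc_cases)
      case (endpoint m)
      then show ?thesis by (simp add: arc_lift_end F_ends)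
    next
      case (arc m x)
      have "F t = F (c x + 2 * pi * real_of_int m)" by (simp add: arc c_def algebra_simps)
      also have "\<dots> = c (f x) + 2 * pi * m" using periodic_homeos_int[OF F] cf by simp
      finally show ?thesis by (simp add: arc arc_lift_arc c_def)
    qed
  qed
qed

lemma homeo_on_translation: "(\<lambda>x. x + d) \<in> homeo_on UNIV"
proof (rule homeo_onI)
  show "\<exists>x. x + d = y" for y by (rule exI[of _ "y - d"]) simp
qed auto

text \<open>Every periodic homeomorphism is, up to a multiple of the period, a product of two which have
  fixed points: the first factor moves \<open>F 0\<close> back to \<open>0\<close> inside an arc containing both.\<close>

lemma circle_map_in_small_index_subgroup:
  assumes H: "subgroup H (Homeo_group circle)" "rcosets\<^bsub>Homeo_group circle\<^esub> H \<prec> (UNIV :: nat set set)"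
    and F: "F \<in> periodic_homeos"
  shows "circle_map F \<in> H"
proof -
  interpret group "Homeo_group circle" by (rule group_Homeo_group)
  have mult: "circle_map (F \<circ> G) = circle_map F \<otimes>\<^bsub>Homeo_group circle\<^esub> circle_map G"
    if "F \<in> periodic_homeos" "G \<in> periodic_homeos" for F G
    using that by (simp add: circle_map_comp mult_Homeo_group circle_map_Homeo)
  have arc: "circle_map (arc_lift \<theta> f) \<in> H" if "f \<in> homeo_on UNIV" for \<theta> f
    using that by (intro homeo_on_image_in_small_index_subgroup[OF H, of "\<lambda>f. circle_map (arc_lift \<theta> f)"])
      (auto simp: carrier_Homeo_group circle_map_Homeo arc_lift_periodic_homeos arc_lift_comp mult)
  \<comment> \<open>Removing whole turns does not change the circle map and brings
    \<open>G 0\<close> into the first period.\<close>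
  define m where "m = \<lfloor>F 0 / (2 * pi)\<rfloor>"
  define G where "G t = F t - 2 * pi * m" for t
  have "of_int m \<le> F 0 / (2 * pi)" "F 0 / (2 * pi) < of_int m + 1"
    unfolding m_def by linarith+
  then have G0: "0 \<le> G 0" "G 0 < 2 * pi" by (auto simp: G_def field_simps)
  have "(\<lambda>x. x + - (2 * pi * m)) \<circ> F \<in> homeo_on UNIV"
    using F by (intro comp_homeo_on homeo_on_translation) (simp add: periodic_homeos_def)
  then have G: "G \<in> periodic_homeos"
    using F by (simp add: periodic_homeos_def G_def[abs_def] comp_def)
  have FG: "circle_map F = circle_map G"
  proof (rule eq_on_circle)
    have "cis (F t) = cis (G t)" for t using cis_eq_cis_iff[of "F t" "G t"] by (auto simp: G_def)
    then show "circle_map F (cis t) = circle_map G (cis t)" for t by (simp add: circle_map_cis F G)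
  qed (auto simp: circle_map_def)
  \<comment> \<open>This centres the arc at \<open>G 0 / 2\<close>; its half-length
    \<open>pi\<close> exceeds the distance \<open>G 0 / 2\<close> to both \<open>0\<close> and
    \<open>G 0\<close>.\<close>
  define \<theta> where "\<theta> = G 0 / 2 - pi"
  define x where "x = tan ((G 0 - \<theta> - pi) / 2)"
  define y where "y = tan ((0 - \<theta> - pi) / 2)"
  have xy: "G 0 = \<theta> + pi + 2 * arctan x" "0 = \<theta> + pi + 2 * arctan y"
    unfolding x_def y_def using G0 by (intro arc_interior; simp add: \<theta>_def)+
  \<comment> \<open>A translation in the arc coordinate, taking the coordinate of \<open>G 0\<close>
    to that of \<open>0\<close>.\<close>
  define f where "f = (\<lambda>z. z + (y - x))"
  have f: "f \<in> homeo_on UNIV" unfolding f_def by (rule homeo_on_translation)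
  note A = arc_lift_periodic_homeos[OF f, of \<theta>]
  have "arc_lift \<theta> f (G 0) = 0"
    using arc_lift_arc[of \<theta> f 0 x] xy by (simp add: f_def)
  moreover have AG: "arc_lift \<theta> f \<circ> G \<in> periodic_homeos" using A G by (rule periodic_homeos_comp)
  ultimately obtain g where g: "g \<in> homeo_on UNIV" "arc_lift 0 g = arc_lift \<theta> f \<circ> G"
    using arc_lift_surj[of "arc_lift \<theta> f \<circ> G" 0] by auto
  have "circle_map (arc_lift \<theta> f) \<otimes>\<^bsub>Homeo_group circle\<^esub> circle_map G \<in> H"
    using arc[OF g(1), of 0] g(2) mult[OF A G] by simp
  then have "inv\<^bsub>Homeo_group circle\<^esub> circle_map (arc_lift \<theta> f) \<otimes>\<^bsub>Homeo_group circle\<^esub>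
      (circle_map (arc_lift \<theta> f) \<otimes>\<^bsub>Homeo_group circle\<^esub> circle_map G) \<in> H"
    by (rule subgroup.m_closed[OF H(1) subgroup.m_inv_closed[OF H(1) arc[OF f]]])
  moreover have "circle_map (arc_lift \<theta> f) \<in> carrier (Homeo_group circle)" "circle_map G \<in> carrier (Homeo_group circle)"
    using A G by (simp_all add: carrier_Homeo_group circle_map_Homeo)
  ultimately show ?thesis by (simp add: FG m_assoc[symmetric])
qed

section \<open>Lifts of arbitrary circle homeomorphisms and orientation\<close>

lemma Homeo_circle_cis_eq:
  assumes f: "f \<in> Homeo circle" shows "f (cis s) = f (cis t) \<longleftrightarrow> cis s = cis t"
  using homeomorphic_imp_injective_map[of circle circle f] f by (auto simp: Homeo_def inj_on_def)

text \<open>If the lift advanced by two or more periods in one turn, it would take the value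
  \<open>F t + 2 * pi\<close> strictly inside that turn, against injectivity on the circle.\<close>

lemma lift_periodic_homeos:
  assumes f: "f \<in> Homeo circle" and cont: "continuous_on UNIV F" and mono: "strict_mono F"
    and lift: "\<And>t. f (cis t) = cis (F t)"
  shows "F \<in> periodic_homeos"
proof -
  have period: "F (t + 2 * pi) = F t + 2 * pi" for t
  proof -
    have "cis (t + 2 * pi) = cis t" by (simp add: complex_eq_iff)
    then have "cis (F (t + 2 * pi)) = cis (F t)" using lift by metis
    then obtain n :: int where n: "F (t + 2 * pi) = F t + 2 * pi * n" using cis_eq_cis_iff by blast
    have "F t < F (t + 2 * pi)" using mono by (simp add: strict_mono_less)
    then have "0 < n" using n by (simp add: zero_less_mult_iff)
    moreover have "n < 2"
    proof (rule ccontr)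
      assume "\<not> n < 2"
      then have n2: "2 * pi * 2 \<le> 2 * pi * real_of_int n" by simp
      have "\<exists>s\<ge>t. s \<le> t + 2 * pi \<and> F s = F t + 2 * pi"
        using n n2 cont by (intro IVT') (auto intro: continuous_on_subset)
      then obtain s where s: "t \<le> s" "s \<le> t + 2 * pi" "F s = F t + 2 * pi" by blast
      then have st: "s \<noteq> t" "s \<noteq> t + 2 * pi" using n n2 by auto
      have "cis (F s) = cis (F t)" unfolding s(3) by (simp add: complex_eq_iff)
      then have "cis s = cis t" using Homeo_circle_cis_eq[OF f] lift by simp
      then obtain k :: int where k: "s = t + 2 * pi * k" using cis_eq_cis_iff by blast
      have "t < s" "s < t + 2 * pi" using s st by auto
      then have "0 < 2 * pi * real_of_int k" "2 * pi * real_of_int k < 2 * pi * 1" using k by linarith+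
      then have "0 < k" "k < 1" by (simp_all add: zero_less_mult_iff)
      then show False by simp
    qed
    ultimately have "n = 1" by simp
    then show ?thesis using n by simp
  qed
  have nat: "F (t + 2 * pi * real n) = F t + 2 * pi * n" for t n
  proof (induction n)
    case (Suc n)
    then show ?case using period[of "t + 2 * pi * real n"] by (simp add: algebra_simps)
  qed simp
  have "\<exists>x. F x = y" for y
  proof -
    obtain n where "\<bar>y\<bar> + \<bar>F 0\<bar> \<le> real n" using real_arch_simple by blast
    moreover have "real n \<le> 2 * pi * real n" using pi_ge_two mult_right_mono[of 1 "2 * pi" "real n"] by simp
    ultimately have "F (- (2 * pi * real n)) \<le> y" "y \<le> F (2 * pi * real n)"
      using nat[of "- (2 * pi * real n)" n] nat[of 0 n] by auto
    then show ?thesis using IVT'[of F "- (2 * pi * real n)" y "2 * pi * real n"] cont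
      by (auto intro: continuous_on_subset)
  qed
  then have "F \<in> homeo_on UNIV" using mono by (intro homeo_onI) (auto simp: strict_mono_less)
  then show ?thesis using period by (simp add: periodic_homeos_def)
qed

lemma Homeo_plus_circle_eq: "Homeo_plus_circle = circle_map ` periodic_homeos"
proof (intro equalityI subsetI)
  fix f assume "f \<in> Homeo_plus_circle"
  then obtain F where F: "f \<in> Homeo circle" "continuous_on UNIV F" "strict_mono F" "\<And>t. f (cis t) = cis (F t)"
    by (auto simp: Homeo_plus_circle_def)
  then have P: "F \<in> periodic_homeos" by (rule lift_periodic_homeos)
  have "f = circle_map F"
  proof (rule eq_on_circle)
    show "f \<in> extensional (sphere 0 1)" using F(1) by (simp add: Homeo_def)
    show "circle_map F \<in> extensional (sphere 0 1)" by (simp add: circle_map_def)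
    show "f (cis t) = circle_map F (cis t)" for t by (simp add: F(4) circle_map_cis P)
  qed
  then show "f \<in> circle_map ` periodic_homeos" using P by blast
next
  fix f assume "f \<in> circle_map ` periodic_homeos"
  then obtain F where F: "F \<in> periodic_homeos" "f = circle_map F" by blast
  then have F': "F \<in> homeo_on UNIV" by (simp add: periodic_homeos_def)
  then have "continuous_on UNIV F \<and> strict_mono F \<and> (\<forall>t. f (cis t) = cis (F t))"
    using F circle_map_cis[OF F(1)] continuous_homeo_on[OF F'] by (simp add: homeo_on_def)
  then show "f \<in> Homeo_plus_circle"
    using F circle_map_Homeo[OF F(1)] unfolding Homeo_plus_circle_def by blast
qed

text \<open>The lift is the imaginary part of a continuous logarithm. Its gain over one turn is
  continuous with discrete values, hence a constant \<open>c\<close>. Equal values of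
  \<open>F\<close> occur only a whole number of turns apart, so \<open>c \<noteq> 0\<close> gives
  injectivity.\<close>

lemma Homeo_circle_lift:
  assumes f: "f \<in> Homeo circle"
  obtains F where "continuous_on UNIV F" "inj F" "\<And>t. f (cis t) = cis (F t)"
proof -
  have hom: "homeomorphic_map circle circle f" using f by (simp add: Homeo_def)
  have contf: "continuous_on (sphere 0 1) f" and imf: "f ` sphere 0 1 = sphere 0 1"
    using homeomorphic_imp_continuous_map[OF hom] homeomorphic_imp_surjective_map[OF hom] by auto
  have norm: "norm (f (cis t)) = 1" for t
  proof -
    have "f (cis t) \<in> f ` sphere 0 1" by simp
    then show ?thesis using imf by simp
  qed
  have "continuous_on UNIV (\<lambda>t. f (cis t))"
    by (rule continuous_on_compose2[OF contf]) (auto intro!: continuous_intros)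
  moreover have "f (cis t) \<noteq> 0" for t using norm[of t] by auto
  ultimately obtain g :: "real \<Rightarrow> complex" where g: "continuous_on UNIV g" "\<And>t. f (cis t) = exp (g t)"
    using continuous_logarithm_on_contractible[of UNIV "\<lambda>t. f (cis t)"] by (auto simp: contractible_UNIV)
  define F where "F t = Im (g t)" for t
  have "Re (g t) = 0" for t using norm[of t] g(2)[of t] by simp
  then have lift: "f (cis t) = cis (F t)" for t
    using g(2)[of t] by (simp add: exp_eq_polar F_def)
  have cont: "continuous_on S F" for S
    unfolding F_def using g(1) by (intro continuous_intros) (rule continuous_on_subset, auto)
  define D where "D t = F (t + 2 * pi) - F t" for t
  have Dn: "\<exists>n :: int. D t = 2 * pi * n" for t
  proof -
    have "cis (t + 2 * pi) = cis t" by (simp add: complex_eq_iff)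
    then have "cis (F (t + 2 * pi)) = cis (F t)" using lift by metis
    then obtain n :: int where "F (t + 2 * pi) = F t + 2 * pi * n" using cis_eq_cis_iff by blast
    then show ?thesis by (auto simp: D_def)
  qed
  have contD: "continuous_on UNIV D"
    unfolding D_def by (intro continuous_intros continuous_on_compose2[OF cont[of UNIV]]) auto
  have "D constant_on UNIV"
  proof (rule continuous_discrete_range_constant[OF connected_UNIV contD])
    fix t
    have "2 * pi \<le> norm (D s - D t)" if ne: "D s \<noteq> D t" for s
    proof -
      obtain m n :: int where mn: "D s = 2 * pi * m" "D t = 2 * pi * n" using Dn by blast
      then have "D s - D t = 2 * pi * real_of_int (m - n)" by (simp add: algebra_simps)
      moreover have "1 \<le> \<bar>real_of_int (m - n)\<bar>"
      proof -
        have "1 \<le> \<bar>m - n\<bar>" using mn ne by auto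
        then have "real_of_int 1 \<le> real_of_int \<bar>m - n\<bar>" by (simp only: of_int_le_iff)
        then show ?thesis by simp
      qed
      ultimately show ?thesis by (simp add: abs_mult)
    qed
    then show "\<exists>e>0. \<forall>s. s \<in> UNIV \<and> D s \<noteq> D t \<longrightarrow> e \<le> norm (D s - D t)"
      by (intro exI[of _ "2 * pi"]) auto
  qed
  then obtain c where c: "\<And>t. D t = c" by (auto simp: constant_on_def)
  have shift: "F (t + 2 * pi * real n) = F t + real n * c" for t n
  proof (induction n)
    case (Suc n)
    then show ?case using c[of "t + 2 * pi * real n"] by (simp add: D_def algebra_simps)
  qed simp
  have local_inj: "s = t" if "F s = F t" "0 < s" "s < 2 * pi" "0 \<le> t" "t < 2 * pi" for s t
  proof -
    have "cis s = cis t" using that Homeo_circle_cis_eq[OF f] lift by metis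
    then obtain k :: int where k: "s = t + 2 * pi * k" using cis_eq_cis_iff by blast
    then have "2 * pi * real_of_int k < 2 * pi * 1" "2 * pi * (- 1) < 2 * pi * real_of_int k"
      using that unfolding k by linarith+
    then have "real_of_int k < 1" "-1 < real_of_int k"
      using mult_less_cancel_left_pos[of "2 * pi" k 1] mult_less_cancel_left_pos[of "2 * pi" "-1" k] by simp_all
    then have "k = 0" by linarith
    then show ?thesis using k by simp
  qed
  \<comment> \<open>If the lift closed up, the value midway between \<open>F 0\<close> and
    \<open>F pi\<close> would be taken in both halves of the turn.\<close>
  have "c \<noteq> 0"
  proof
    assume "c = 0"
    then have F2: "F (2 * pi) = F 0" using c[of 0] by (simp add: D_def)
    define v where "v = (F 0 + F pi) / 2"
    have ne: "F pi \<noteq> F 0" using local_inj[of pi 0] by auto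
    have "\<exists>s\<ge>0. s \<le> pi \<and> F s = v"
      using IVT'[of F 0 v pi] IVT2'[of F pi v 0] cont by (cases "F 0 \<le> F pi") (auto simp: v_def)
    moreover have "\<exists>s\<ge>pi. s \<le> 2 * pi \<and> F s = v"
      using IVT'[of F pi v "2 * pi"] IVT2'[of F "2 * pi" v pi] cont F2 by (cases "F 0 \<le> F pi") (auto simp: v_def)
    ultimately obtain s t where st: "0 \<le> s" "s \<le> pi" "F s = v" "pi \<le> t" "t \<le> 2 * pi" "F t = v" by blast
    have "s \<noteq> 0" "s \<noteq> pi" "t \<noteq> 2 * pi" using st F2 ne by (auto simp: v_def)
    then show False using local_inj[of s t] st by auto
  qed
  have "inj F"
  proof (rule linorder_injI)
    fix s t :: real assume "s < t"
    show "F s \<noteq> F t"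
    proof
      assume eq: "F s = F t"
      then have "cis t = cis s" using Homeo_circle_cis_eq[OF f] lift by metis
      then obtain k :: int where k: "t = s + 2 * pi * k" using cis_eq_cis_iff by blast
      then have "0 < k" using \<open>s < t\<close> by (simp add: zero_less_mult_iff)
      then have "F t = F s + real (nat k) * c" using shift[of s "nat k"] k by simp
      then show False using eq \<open>c \<noteq> 0\<close> \<open>0 < k\<close> by simp
    qed
  qed
  then show thesis using that cont lift by blast
qed

abbreviation circle_cnj :: "complex \<Rightarrow> complex" where
  "circle_cnj \<equiv> restrict cnj (sphere 0 1)"

lemma circle_cnj_Homeo: "circle_cnj \<in> Homeo circle"
proof -
  have "continuous_map circle circle cnj" by (auto intro!: continuous_intros)
  then have "homeomorphic_maps circle circle cnj cnj" by (auto simp: homeomorphic_maps_def)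
  then have "homeomorphic_map circle circle cnj" by (auto simp: homeomorphic_map_maps)
  then have "homeomorphic_map circle circle circle_cnj" by (rule homeomorphic_map_eq) auto
  then show ?thesis by (simp add: Homeo_def)
qed

lemma circle_cnj_cis: "circle_cnj (cis t) = cis (- t)"
  by (simp add: cis_cnj)

lemma Homeo_circle_cases:
  assumes f: "f \<in> Homeo circle"
  shows "f \<in> Homeo_plus_circle \<or> compose (sphere 0 1) f circle_cnj \<in> Homeo_plus_circle"
proof -
  obtain F where F: "continuous_on UNIV F" "inj F" "\<And>t. f (cis t) = cis (F t)" 
    by (rule Homeo_circle_lift[OF f], blast)
  have "strict_mono F \<or> strict_antimono_on UNIV F"
    using injective_eq_monotone_map[of UNIV F] F by (simp add: is_interval_univ)
  then show ?thesis
  proof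
    assume "strict_mono F"
    then show ?thesis using f F by (auto simp: Homeo_plus_circle_def)
  next
    assume F': "strict_antimono_on UNIV F"
    interpret group "Homeo_group circle" by (rule group_Homeo_group)
    have "compose (sphere 0 1) f circle_cnj \<in> Homeo circle"
      using m_closed[of f circle_cnj] f circle_cnj_Homeo by (simp add: carrier_Homeo_group mult_Homeo_group)
    moreover have "continuous_on UNIV (\<lambda>t. F (- t))"
      by (rule continuous_on_compose2[OF F(1)]) (auto intro: continuous_intros)
    moreover have "strict_mono (\<lambda>t. F (- t))" using F' by (auto simp: monotone_on_def)
    moreover have "compose (sphere 0 1) f circle_cnj (cis t) = cis (F (- t))" for t
      using F(3)[of "- t"] circle_cnj_cis[of t] by (simp add: compose_eq)
    ultimately show ?thesis unfolding Homeo_plus_circle_def by blast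
  qed
qed

text \<open>A lift has the form \<open>- t + 2 * pi * n t\<close>. To increase from \<open>0\<close>
  over \<open>pi / 2\<close> to \<open>pi\<close>, it needs \<open>n\<close> to grow by at least 2,
  whereas periodicity allows growth by at most 1.\<close>

lemma circle_cnj_not_plus: "circle_cnj \<notin> Homeo_plus_circle"
proof
  assume "circle_cnj \<in> Homeo_plus_circle"
  then obtain F where F: "F \<in> periodic_homeos" "circle_cnj = circle_map F"
    by (auto simp: Homeo_plus_circle_eq)
  have F': "F \<in> homeo_on UNIV" using F by (simp add: periodic_homeos_def)
  have "\<exists>n :: int. F t = - t + 2 * pi * n" for t
  proof -
    have "cis (F t) = cis (- t)" using circle_map_cis[OF F(1)] F(2) circle_cnj_cis by metis
    then show ?thesis using cis_eq_cis_iff by blast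
  qed
  then obtain n :: "real \<Rightarrow> int" where n: "\<And>t. F t = - t + 2 * pi * n t" by metis
  have less: "F 0 < F (pi / 2)" "F (pi / 2) < F pi" "F pi < F (2 * pi)" by (simp_all add: homeo_on_less[OF F'])
  have "F (2 * pi) = F 0 + 2 * pi" using periodic_homeos_int[OF F(1), of 0 1] by simp
  then have "pi * (2 * real_of_int (n pi)) < pi * (2 * n 0 + 3)" "pi * (2 * n 0) < pi * (2 * real_of_int (n (pi / 2)) - 1/2)"
    "pi * (2 * real_of_int (n (pi / 2)) - 1/2) < pi * (2 * n pi - 1)"
    using less n[of 0] n[of pi] n[of "pi / 2"] by (simp_all add: algebra_simps)
  then have "2 * real_of_int (n pi) < 2 * n 0 + 3" "2 * n 0 < 2 * real_of_int (n (pi / 2)) - 1/2"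
    "2 * real_of_int (n (pi / 2)) - 1/2 < 2 * n pi - 1"
    by (simp_all only: mult_less_cancel_left_pos[OF pi_gt_zero])
  then have "n 0 < n (pi / 2)" "n (pi / 2) < n pi" "n pi \<le> n 0 + 1" by linarith+
  then show False by linarith
qed

theorem small_index_subgroups_circle:
  "{H. subgroup H (Homeo_group circle) \<and> H \<noteq> carrier (Homeo_group circle) \<and>
      (rcosets\<^bsub>Homeo_group circle\<^esub> H) \<prec> (UNIV :: nat set set)} = {Homeo_plus_circle}"
proof -
  interpret group "Homeo_group circle" by (rule group_Homeo_group)
  have mult: "circle_map F \<otimes>\<^bsub>Homeo_group circle\<^esub> circle_map G = circle_map (F \<circ> G)"
    if "F \<in> periodic_homeos" "G \<in> periodic_homeos" for F G
    using that by (simp add: circle_map_comp mult_Homeo_group circle_map_Homeo)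
  have "id \<in> periodic_homeos" by (simp add: periodic_homeos_def id_homeo_on)
  have inv: "inv\<^bsub>Homeo_group circle\<^esub> circle_map F = circle_map (finv F)" if F: "F \<in> periodic_homeos" for F
  proof (rule inv_equality)
    have "finv F \<circ> F = id" using F by (auto simp: periodic_homeos_def homeo_on_inv_f)
    then show "circle_map (finv F) \<otimes>\<^bsub>Homeo_group circle\<^esub> circle_map F = \<one>\<^bsub>Homeo_group circle\<^esub>"
      by (simp add: mult F periodic_homeos_inv circle_map_id)
        (auto simp: Homeo_group_def BijGroup_def restrict_def)
  qed (simp_all add: carrier_Homeo_group circle_map_Homeo F periodic_homeos_inv)
  show ?thesis
  proof (rule unique_small_index_subgroup)
    show "subgroup Homeo_plus_circle (Homeo_group circle)"
      unfolding Homeo_plus_circle_eq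
    proof (rule subgroupI)
      show "circle_map ` periodic_homeos \<subseteq> carrier (Homeo_group circle)"
        by (auto simp: carrier_Homeo_group circle_map_Homeo)
    qed (use \<open>id \<in> periodic_homeos\<close> in \<open>auto simp: mult inv periodic_homeos_comp periodic_homeos_inv\<close>)
    show "circle_cnj \<in> carrier (Homeo_group circle)" "circle_cnj \<notin> Homeo_plus_circle"
      using circle_cnj_Homeo circle_cnj_not_plus by (simp_all add: carrier_Homeo_group)
    show "x \<in> Homeo_plus_circle \<or> x \<otimes>\<^bsub>Homeo_group circle\<^esub> circle_cnj \<in> Homeo_plus_circle"
      if "x \<in> carrier (Homeo_group circle)" for x
      using that Homeo_circle_cases[of x] circle_cnj_Homeo by (simp add: mult_Homeo_group carrier_Homeo_group)
    show "Homeo_plus_circle \<subseteq> H"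
      if "subgroup H (Homeo_group circle)" "rcosets\<^bsub>Homeo_group circle\<^esub> H \<prec> (UNIV :: nat set set)" for H
      using circle_map_in_small_index_subgroup[OF that] by (auto simp: Homeo_plus_circle_eq)
  qed
qed

theorem mainTheorem3:
  shows "{H. subgroup H (Homeo_group euclideanreal) \<and> H \<noteq> carrier (Homeo_group euclideanreal) \<and>
             (rcosets\<^bsub>Homeo_group euclideanreal\<^esub> H) \<prec> (UNIV :: nat set set)}
           = {Homeo_plus_real}
       \<and> {H. subgroup H (Homeo_group circle) \<and> H \<noteq> carrier (Homeo_group circle) \<and>
             (rcosets\<^bsub>Homeo_group circle\<^esub> H) \<prec> (UNIV :: nat set set)}
           = {Homeo_plus_circle}"
  using small_index_subgroups_real small_index_subgroups_circle by (rule conjI)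

end
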